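(* For every $h\in C_\mathbb{R}([-R,R]^n)$ and every $\mu_1,\dots,\mu_n\in\mathrm{Prob}([-R,R])$, $$P(h)\ge P_\mathrm{sym}(h:\mu_1,\dots,\mu_n)+\sum_{i=1}^nH(\mu_i).$$ Moreover the following are equivalent: (i) $P(h)=P_\mathrm{sym}(h:\mu_1,\dots,\mu_n)+\sum_{i=1}^nH(\mu_i)$; (ii) $\mu_1,\dots,\mu_n$ are the marginals of the Gibbs measure $\mu_h$ associated with $h$; (iii) for each $i=1,\dots,n$, $\mu_i$ is the Gibbs measure on $[-R,R]$ associated with $h_i\in C_\mathbb{R}([-R,R])$, where $$h_i(x)=\log\int_{[-R,R]^{n-1}}e^{h(x_1,\dots,x_{i-1},x,x_{i+1},\dots,x_n)}\,dx_1\cdots dx_{i-1}dx_{i+1}\cdots dx_n.$$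
   Context: Fix $R>0$ and $n\in\mathbb{N}$. $\mathrm{Prob}([-R,R]^k)$ denotes Borel probability measures on $[-R,R]^k$; $C_\mathbb{R}([-R,R]^k)$ the real continuous functions with sup-norm. The Boltzmann–Gibbs entropy of $\mu\in\mathrm{Prob}([-R,R]^k)$ is $H(\mu)=-\int p\log p\,d\mathbf{x}$ if $\mu$ has a density $p$ with respect to Lebesgue measure, and $H(\mu)=-\infty$ otherwise. The pressure of $h\in C_\mathbb{R}([-R,R]^k)$ is $P(h)=\log\int_{[-R,R]^k}e^{h(\mathbf{x})}d\mathbf{x}$, and the Gibbs measure associated with $h$ is $d\mu_h=e^{-P(h)}e^{h(\mathbf{x})}d\mathbf{x}$. Marginals are images under coordinate projections. For $\mathbf{x}\in\mathbb{R}^N$ let $\kappa_N(\mathbf{x})=\frac1N\sum_jx_j$ (powers coordinatewise); $[-R,R]_\le^N$ is the set of vectors in $[-R,R]^N$ with nondecreasing coordinates; $S_N$ acts by $\sigma(\mathbf{x})=(x_{\sigma^{-1}(1)},\dots,x_{\sigma^{-1}(N)})$. An approximating sequence for $(\mu_1,\dots,\mu_n)$ is $\Xi(N)=(\xi_1(N),\dots,\xi_n(N))$ with $\xi_i(N)\in[-R,R]_\le^N$ and $\kappa_N(\xi_i(N)^k)\to\int x^k\,d\mu_i$ for all $k$. For $h\in C_\mathbb{R}([-R,R]^n)$, $\kappa_N(h(\mathbf{x}_1,\dots,\mathbf{x}_n))=\frac1N\sum_{j=1}^Nh(x_{1j},\dots,x_{nj})$. The mutual pressure is $$P_\mathrm{sym}(h:\mu_1,\dots,\mu_n)=\limsup_{N\to\infty}\frac1N\log\Biggl[\frac1{(N!)^n}\sum_{\sigma_1,\dots,\sigma_n\in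 S_N}\exp\bigl(N\kappa_N(h(\sigma_1(\xi_1(N)),\dots,\sigma_n(\xi_n(N))))\bigr)\Biggr]$$ (independent of the approximating sequence). *)

theory Defs
  imports "HOL-Probability.Probability"
begin

definition cube :: "'i set \<Rightarrow> real \<Rightarrow> ('i \<Rightarrow> real) set" where
  "cube I R = PiE I (\<lambda>_. {-R..R})"

definition leb :: "'i set \<Rightarrow> ('i \<Rightarrow> real) measure" where
  "leb I = PiM I (\<lambda>_. lborel)"

definition pressure :: "real \<Rightarrow> (('n::finite \<Rightarrow> real) \<Rightarrow> real) \<Rightarrow> real" where
  "pressure R h = ln (LINT x : cube UNIV R | leb UNIV. exp (h x))"

definition gibbs :: "real \<Rightarrow> (('n::finite \<Rightarrow> real) \<Rightarrow> real) \<Rightarrow> ('n \<Rightarrow> real) measure" where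
  "gibbs R h = density (leb UNIV)
      (\<lambda>x. ennreal (indicator (cube UNIV R) x * exp (h x - pressure R h)))"

definition pressure1 :: "real \<Rightarrow> (real \<Rightarrow> real) \<Rightarrow> real" where
  "pressure1 R g = ln (LINT x : {-R..R} | lborel. exp (g x))"

definition gibbs1 :: "real \<Rightarrow> (real \<Rightarrow> real) \<Rightarrow> real measure" where
  "gibbs1 R g = density lborel
      (\<lambda>x. ennreal (indicator {-R..R} x * exp (g x - pressure1 R g)))"

definition partial_h :: "real \<Rightarrow> (('n::finite \<Rightarrow> real) \<Rightarrow> real) \<Rightarrow> 'n \<Rightarrow> real \<Rightarrow> real" where
  "partial_h R h i x =
     ln (LINT y : cube (UNIV - {i}) R | leb (UNIV - {i}). exp (h (y(i := x))))"

definition prob_on :: "real \<Rightarrow> real measure \<Rightarrow> bool" where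
  "prob_on R \<mu> \<longleftrightarrow> prob_space \<mu> \<and> sets \<mu> = sets borel \<and> emeasure \<mu> {-R..R} = 1"

definition plogp :: "real \<Rightarrow> real" where
  "plogp t = (if t = 0 then 0 else t * ln t)"

definition has_density :: "real measure \<Rightarrow> bool" where
  "has_density \<mu> \<longleftrightarrow> (\<exists>p. p \<in> borel_measurable borel \<and> \<mu> = density lborel p)"

definition entropy_BG :: "real measure \<Rightarrow> ereal" where
  "entropy_BG \<mu> =
    (if has_density \<mu> then
       (let p = (\<lambda>x. enn2real ((SOME p. p \<in> borel_measurable borel \<and> \<mu> = density lborel p) x))
        in enn2ereal (\<integral>\<^sup>+ x. ennreal (- plogp (p x)) \<partial>lborel)
           - enn2ereal (\<integral>\<^sup>+ x. ennreal (plogp (p x)) \<partial>lborel))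
     else -\<infinity>)"

text \<open>Approximating sequence: xi i N is the vector (xi i N 0, ..., xi i N (N-1)).\<close>
definition approximating ::
  "real \<Rightarrow> ('n::finite \<Rightarrow> real measure) \<Rightarrow> ('n \<Rightarrow> nat \<Rightarrow> nat \<Rightarrow> real) \<Rightarrow> bool" where
  "approximating R \<mu> \<xi> \<longleftrightarrow>
     (\<forall>i N j. j < N \<longrightarrow> \<xi> i N j \<in> {-R..R}) \<and>
     (\<forall>i N j k. j \<le> k \<longrightarrow> k < N \<longrightarrow> \<xi> i N j \<le> \<xi> i N k) \<and>
     (\<forall>i (k::nat). (\<lambda>N. (\<Sum>j<N. (\<xi> i N j) ^ k) / real N)
                    \<longlonglongrightarrow> integral\<^sup>L (\<mu> i) (\<lambda>x. x ^ k))"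

text \<open>Mutual pressure computed along the approximating sequence xi;
  sigma acts by (sigma x)_j = x_(sigma^-1 j).\<close>
definition mutual_pressure ::
  "(('n::finite \<Rightarrow> real) \<Rightarrow> real) \<Rightarrow> ('n \<Rightarrow> nat \<Rightarrow> nat \<Rightarrow> real) \<Rightarrow> ereal" where
  "mutual_pressure h \<xi> = limsup (\<lambda>N. ereal (
     ln ((\<Sum>s \<in> PiE UNIV (\<lambda>_. {\<sigma>. \<sigma> permutes {..<N}}).
            exp (\<Sum>j<N. h (\<lambda>i. \<xi> i N (inv (s i) j))))
         / (fact N) ^ CARD('n)) / real N))"

end

theory Submission
  imports Defs
begin

text \<open>
  Write S(w) for the average over independent column permutations of exp(sum of h over the rows)
  of an array w, so that the mutual pressure is the limsup of (ln S)/N along the approximating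
  arrays, and let \<pi> be the product of the \<mu>_i with densities p_i.

  Since h is uniformly continuous and S does not change when columns are sorted, (ln S)/N is
  controlled by the L1 distance between the empirical distribution functions of the columns. Hence
  the approximating array may be replaced by N independent rows drawn from any law with marginals
  \<mu>_i, and (ln S)/N by its expectation.

  Drawing the rows from \<pi> and putting g = h - sum of ln p_i, permutation invariance gives
  E S_g = (integral of e^g d\<pi>)^N \<le> e^(N P(h)), and Jensen's inequality for ln yields
  the bound. If the \<mu>_i are the marginals of the Gibbs measure, whose density with respect to
  \<pi> is e^(g-P), then drawing the rows from it gives E ln S_(g-P) = E_\<pi> S_(g-P) ln S_(g-P) \<ge> 0,
  which is the reverse bound.

  Conversely, in case of equality, apply the bound to h + t 1_A(x_i): permutations do not see the
  added term, so t \<mu>_i(A) \<le> P(h + t 1_A(x_i)) - P(h) for all t > 0, and t \<rightarrow> 0 gives that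
  \<mu>_i(A) is at most the Gibbs marginal of A.
\<close>

section \<open>Averages over permutations of the columns\<close>

text \<open>The limsup runs along a fixed array of which only the column moments are controlled,
  whereas the entropies involve densities that may be unbounded or vanish. Random rows reconcile the
  two. Only the continuous \<open>h\<close> is ever compared between arrays; the logarithms of the
  densities enter afterwards, as a separable term that factors out of S exactly and whose
  expectation depends on the marginals alone. Apart from its marginals the law of the rows is free,
  so one comparison serves the product measure for one bound and the Gibbs measure for the other.
  Both bounds are exact for each N > 0; only the comparison with the given array is asymptotic. This
  also makes the perturbation in the equality case legitimate: an indicator is not continuous, but
  the upper bound for fixed N asks only for a bounded measurable potential, whence the two locales
  \<open>cts_potential\<close> and \<open>bdd_potential\<close>. The perturbed pressure is explicit,
  P(h) + ln (1 + (e^t - 1) q) with q the Gibbs mass, so its slope at t = 0 is q.\<close>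

definition perm_families :: "nat \<Rightarrow> ('n::finite \<Rightarrow> nat \<Rightarrow> nat) set" where
  "perm_families N = PiE UNIV (\<lambda>_. {\<sigma>. \<sigma> permutes {..<N}})"

text \<open>Arrays are indexed row first: \<open>w j\<close> is a point of the n-dimensional space,
  so an array with independent rows is a point of a product of N copies of one law.\<close>

definition symm_avg :: "(('n::finite \<Rightarrow> real) \<Rightarrow> real) \<Rightarrow> nat \<Rightarrow> (nat \<Rightarrow> 'n \<Rightarrow> real) \<Rightarrow> real" where
  "symm_avg h N w =
     (\<Sum>s\<in>perm_families N. exp (\<Sum>j<N. h (\<lambda>i. w (s i j) i))) / fact N ^ CARD('n)"

lemma perm_families_iff: "s \<in> perm_families N \<longleftrightarrow> (\<forall>i. s i permutes {..<N})"
  by (auto simp: perm_families_def PiE_iff)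

lemma finite_perm_families [simp]: "finite (perm_families N :: ('n::finite \<Rightarrow> _) set)"
  unfolding perm_families_def by (intro finite_PiE) (auto simp: finite_permutations)

lemma card_perm_families: "card (perm_families N :: ('n::finite \<Rightarrow> _) set) = fact N ^ CARD('n)"
  unfolding perm_families_def by (simp add: card_PiE card_permutations[OF refl])

lemma perm_families_nonempty: "perm_families N \<noteq> ({} :: ('n::finite \<Rightarrow> _) set)"
  by (metis card.empty card_perm_families fact_nonzero power_not_zero)

lemma symm_avg_pos: "symm_avg h N w > 0"
  unfolding symm_avg_def
  by (intro divide_pos_pos sum_pos perm_families_nonempty) auto

text \<open>Inverting every member of a family is a bijection of the families, which removes the
  inverses from the action of the permutations.\<close>

lemma mutual_pressure_symm_avg:
  "mutual_pressure h \<xi> = limsup (\<lambda>N. ereal (ln (symm_avg h N (\<lambda>j i. \<xi> i N j)) / real N))"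
proof -
  have "(\<Sum>s \<in> PiE UNIV (\<lambda>_. {\<sigma>. \<sigma> permutes {..<N}}). exp (\<Sum>j<N. h (\<lambda>i. \<xi> i N (inv (s i) j))))
      = (\<Sum>s \<in> perm_families N. exp (\<Sum>j<N. h (\<lambda>i. \<xi> i N (s i j))))" for N
    unfolding perm_families_def[symmetric]
    by (rule sum.reindex_bij_witness[where i = "\<lambda>s i. inv (s i)" and j = "\<lambda>s i. inv (s i)"])
       (auto simp: perm_families_iff permutes_inv intro!: ext permutes_inv_inv fun_cong[OF permutes_inv_inv])
  then show ?thesis
    by (simp add: mutual_pressure_def symm_avg_def)
qed

text \<open>Composition with a fixed family only relabels the summands. This allows the columns to
  be sorted separately, and it is the invariance behind \<open>symmetrize\<close>.\<close>

lemma symm_avg_permute: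
  fixes \<tau> :: "'n::finite \<Rightarrow> nat \<Rightarrow> nat"
  assumes "\<tau> \<in> perm_families N"
  shows "symm_avg h N (\<lambda>j i. w (\<tau> i j) i) = symm_avg h N w"
proof -
  have t: "\<tau> i permutes {..<N}" for i
    using assms by (simp add: perm_families_iff)
  have "(\<Sum>s\<in>perm_families N. exp (\<Sum>j<N. h (\<lambda>i. w (\<tau> i (s i j)) i)))
      = (\<Sum>s\<in>perm_families N. exp (\<Sum>j<N. h (\<lambda>i. w (s i j) i)))"
    by (rule sum.reindex_bij_witness[where i = "\<lambda>s i. inv (\<tau> i) \<circ> s i" and j = "\<lambda>s i. \<tau> i \<circ> s i"])
       (auto simp: perm_families_iff fun_eq_iff permutes_inverses[OF t]
             intro!: permutes_compose permutes_inv t)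
  then show ?thesis by (simp add: symm_avg_def)
qed

lemma symm_avg_cong:
  assumes "\<And>s j. s \<in> perm_families N \<Longrightarrow> j < N \<Longrightarrow> h (\<lambda>i. w (s i j) i) = h' (\<lambda>i. w' (s i j) i)"
  shows "symm_avg h N w = symm_avg h' N w'"
  unfolding symm_avg_def using assms by (intro arg_cong2[where f="(/)"] sum.cong) auto

text \<open>A sum over the entries of a single column does not notice a permutation of that column.
  Hence such terms may be arbitrary functions, in particular logarithms of densities and
  indicators.\<close>

lemma symm_avg_add_separate:
  fixes f :: "'n::finite \<Rightarrow> real \<Rightarrow> real"
  shows "symm_avg (\<lambda>x. h x + (\<Sum>i\<in>UNIV. f i (x i))) N w
       = symm_avg h N w * exp (\<Sum>i\<in>UNIV. \<Sum>j<N. f i (w j i))"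
proof -
  have "(\<Sum>j<N. h (\<lambda>i. w (s i j) i) + (\<Sum>i\<in>UNIV. f i (w (s i j) i)))
      = (\<Sum>j<N. h (\<lambda>i. w (s i j) i)) + (\<Sum>i\<in>UNIV. \<Sum>j<N. f i (w j i))"
    if s: "s \<in> perm_families N" for s :: "'n \<Rightarrow> nat \<Rightarrow> nat"
  proof -
    have "(\<Sum>j<N. \<Sum>i\<in>UNIV. f i (w (s i j) i)) = (\<Sum>i\<in>UNIV. \<Sum>j<N. f i (w (s i j) i))"
      by (rule sum.swap)
    also have "\<dots> = (\<Sum>i\<in>UNIV. \<Sum>j<N. f i (w j i))"
    proof (rule sum.cong)
      fix i
      show "(\<Sum>j<N. f i (w (s i j) i)) = (\<Sum>j<N. f i (w j i))"
        using s sum.permute[of "s i" "{..<N}" "\<lambda>j. f i (w j i)"]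
        by (simp add: perm_families_iff o_def)
    qed simp
    finally show ?thesis by (simp add: sum.distrib)
  qed
  then show ?thesis
    by (simp add: symm_avg_def exp_add sum_distrib_right)
qed

lemma ln_symm_avg_le:
  fixes h h' :: "('n::finite \<Rightarrow> real) \<Rightarrow> real"
  assumes "\<And>s. s \<in> perm_families N \<Longrightarrow>
    (\<Sum>j<N. h (\<lambda>i. w (s i j) i)) \<le> (\<Sum>j<N. h' (\<lambda>i. w' (s i j) i)) + c"
  shows "ln (symm_avg h N w) \<le> ln (symm_avg h' N w') + c"
proof -
  have "symm_avg h N w \<le> symm_avg h' N w' * exp c"
    unfolding symm_avg_def times_divide_eq_left sum_distrib_right exp_add[symmetric]
    using assms by (intro divide_right_mono sum_mono) auto
  then have "ln (symm_avg h N w) \<le> ln (symm_avg h' N w' * exp c)"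
    using symm_avg_pos by (subst ln_le_cancel_iff) (auto simp: symm_avg_pos)
  also have "\<dots> = ln (symm_avg h' N w') + c"
    using symm_avg_pos[of h' N w'] by (simp add: ln_mult_pos)
  finally show ?thesis .
qed

lemma ln_symm_avg_zero: "ln (symm_avg (\<lambda>_. 0) N (w :: nat \<Rightarrow> 'n::finite \<Rightarrow> real)) = 0"
  by (simp add: symm_avg_def card_perm_families)

lemma abs_ln_symm_avg_le:
  assumes "\<And>x. \<bar>h x\<bar> \<le> B"
  shows "\<bar>ln (symm_avg h N w)\<bar> \<le> real N * B"
proof -
  have b: "h x \<le> B" "- h x \<le> B" for x
    using assms[of x] by auto
  have "(\<Sum>j<N. h (f j)) \<le> real N * B" for f
    using sum_bounded_above[of "{..<N}" "\<lambda>j. h (f j)" B] b by simp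
  then have "ln (symm_avg h N w) \<le> ln (symm_avg (\<lambda>_. 0) N w) + real N * B"
    by (intro ln_symm_avg_le) simp
  moreover have "- (\<Sum>j<N. h (f j)) \<le> real N * B" for f
    using sum_bounded_above[of "{..<N}" "\<lambda>j. - h (f j)" B] b by (simp add: sum_negf)
  then have "0 \<le> (\<Sum>j<N. h (f j)) + real N * B" for f
    using neg_le_iff_le[of "\<Sum>j<N. h (f j)"] by (metis add.commute diff_ge_0_iff_ge diff_minus_eq_add)
  then have "ln (symm_avg (\<lambda>_. 0) N w) \<le> ln (symm_avg h N w) + real N * B"
    by (intro ln_symm_avg_le) simp
  ultimately show ?thesis by (simp add: ln_symm_avg_zero)
qed

text \<open>For each threshold t the index sets of the entries below t of two sorted vectors are
  nested, so no cancellation occurs when their indicators are subtracted.\<close>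
lemma sorted_sum_abs_diff_count:
  fixes x y :: "nat \<Rightarrow> real"
  assumes "\<And>j k. j \<le> k \<Longrightarrow> k < N \<Longrightarrow> x j \<le> x k" "\<And>j k. j \<le> k \<Longrightarrow> k < N \<Longrightarrow> y j \<le> y k"
  shows "(\<Sum>j<N. \<bar>indicator {x j..} t - indicator {y j..} t\<bar>)
       = \<bar>(\<Sum>j<N. indicator {x j..} t) - (\<Sum>j<N. indicator {y j..} t :: real)\<bar>"
proof (cases "\<exists>j<N. x j \<le> t \<and> \<not> y j \<le> t")
  case True
  then obtain j where j: "j < N" "x j \<le> t" "\<not> y j \<le> t" by auto
  \<comment> \<open>One index \<open>j\<close> with \<open>x j \<le> t < y j\<close> fixes the sign
    everywhere: for \<open>k \<le> j\<close> the entry \<open>x k\<close> is at most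
    \<open>t\<close>, and for \<open>k \<ge> j\<close> the entry \<open>y k\<close> exceeds
    \<open>t\<close>.\<close>
  have "indicator {y k..} t \<le> (indicator {x k..} t :: real)" if "k < N" for k
    using assms(1)[of k j] assms(2)[of j k] j that
    by (cases "k \<le> j") (auto split: split_indicator)
  then have "(\<Sum>j<N. \<bar>indicator {x j..} t - indicator {y j..} t\<bar>)
           = (\<Sum>j<N. indicator {x j..} t - indicator {y j..} t :: real)"
    by (intro sum.cong) auto
  then show ?thesis
    using sum_nonneg[of "{..<N}" "\<lambda>j. \<bar>indicator {x j..} t - indicator {y j..} t :: real\<bar>"]
    by (simp add: sum_subtractf)
next
  case False
  then have "indicator {x k..} t \<le> (indicator {y k..} t :: real)" if "k < N" for k
    using that by (auto split: split_indicator)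
  then have "(\<Sum>j<N. \<bar>indicator {x j..} t - indicator {y j..} t\<bar>)
           = (\<Sum>j<N. indicator {y j..} t - indicator {x j..} t :: real)"
    by (intro sum.cong) auto
  then show ?thesis
    using sum_nonneg[of "{..<N}" "\<lambda>j. \<bar>indicator {x j..} t - indicator {y j..} t :: real\<bar>"]
    by (simp add: sum_subtractf)
qed

text \<open>The two indicators differ exactly for \<open>t\<close> from the smaller number up to,
  but excluding, the larger one. The half-open range is kept throughout because clipping is
  invisible to thresholds below \<open>R\<close>, but not at \<open>R\<close>.\<close>

lemma abs_diff_eq_integral_indicator:
  fixes a b R :: real
  assumes "a \<in> {-R..R}" "b \<in> {-R..R}"
  shows "(LINT t:{-R..<R}|lborel. \<bar>indicator {a..} t - indicator {b..} t\<bar>) = \<bar>a - b\<bar>"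
proof -
  have "(LINT t:{-R..<R}|lborel. \<bar>indicator {a..} t - indicator {b..} t :: real\<bar>)
      = (LINT t|lborel. indicator {min a b..<max a b} t)"
    unfolding set_lebesgue_integral_def using assms
    by (intro Bochner_Integration.integral_cong) (auto split: split_indicator)
  also have "\<dots> = \<bar>a - b\<bar>" by simp
  finally show ?thesis .
qed

lemma set_integrable_bounded_lborel:
  fixes f :: "real \<Rightarrow> real"
  assumes [measurable]: "f \<in> borel_measurable borel" and "\<And>t. \<bar>f t\<bar> \<le> B"
  shows "set_integrable lborel {a..<b} f"
  unfolding set_integrable_def
proof (rule Bochner_Integration.integrable_bound[where f = "\<lambda>t. B * indicator {a..<b} t"])
  show "integrable lborel (\<lambda>t. B * indicator {a..<b} t :: real)"
    by (cases "a \<le> b") (auto intro!: integrable_mult_right integrable_real_indicator)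
  have "0 \<le> B" using assms(2)[of 0] by linarith
  then show "AE t in lborel. norm (indicator {a..<b} t *\<^sub>R f t) \<le> norm (B * indicator {a..<b} t)"
    using assms(2) by (auto split: split_indicator)
qed auto

text \<open>The empirical distribution function, with the same closed convention as
  \<open>cdf\<close>. The indicator is taken in the threshold \<open>t\<close>, the variable over
  which it is later integrated.\<close>

definition emp_cdf :: "nat \<Rightarrow> (nat \<Rightarrow> real) \<Rightarrow> real \<Rightarrow> real" where
  "emp_cdf N x t = (\<Sum>j<N. indicator {x j..} t) / real N"

lemma emp_cdf_bounds: "0 \<le> emp_cdf N x t" "emp_cdf N x t \<le> 1"
proof -
  show "0 \<le> emp_cdf N x t" by (auto simp: emp_cdf_def intro!: divide_nonneg_nonneg sum_nonneg)
  have "(\<Sum>j<N. indicator {x j..} t :: real) \<le> (\<Sum>j<N. 1)"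
    by (intro sum_mono) (auto split: split_indicator)
  then show "emp_cdf N x t \<le> 1" by (simp add: emp_cdf_def divide_le_eq)
qed

lemma measurable_emp_cdf [measurable]: "emp_cdf N x \<in> borel_measurable borel"
  unfolding emp_cdf_def[abs_def] by measurable

text \<open>The one-dimensional transport identity: matching sorted entries costs the L1 distance of
  the distribution functions. Each distance is written as an integral over thresholds, and the
  nesting of the level sets lets the sum move inside the absolute value.\<close>

lemma sorted_mean_abs_diff:
  fixes x y :: "nat \<Rightarrow> real"
  assumes "\<And>j k. j \<le> k \<Longrightarrow> k < N \<Longrightarrow> x j \<le> x k" "\<And>j k. j \<le> k \<Longrightarrow> k < N \<Longrightarrow> y j \<le> y k"
    and "\<And>j. j < N \<Longrightarrow> x j \<in> {-R..R}" "\<And>j. j < N \<Longrightarrow> y j \<in> {-R..R}"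
  shows "(\<Sum>j<N. \<bar>x j - y j\<bar>) = real N * (LINT t:{-R..<R}|lborel. \<bar>emp_cdf N x t - emp_cdf N y t\<bar>)"
proof (cases "N = 0")
  case False
  have "(\<Sum>j<N. \<bar>x j - y j\<bar>)
      = (\<Sum>j<N. LINT t:{-R..<R}|lborel. \<bar>indicator {x j..} t - indicator {y j..} t\<bar>)"
    using assms(3,4) by (intro sum.cong refl abs_diff_eq_integral_indicator[symmetric]) auto
  also have "\<dots> = (LINT t:{-R..<R}|lborel. (\<Sum>j<N. \<bar>indicator {x j..} t - indicator {y j..} t\<bar>))"
    unfolding set_lebesgue_integral_def
    by (subst Bochner_Integration.integral_sum[symmetric])
       (auto simp: sum_distrib_left split: split_indicator
        intro!: set_integrable_bounded_lborel[where B=1, unfolded set_integrable_def real_scaleR_def])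
  also have "\<dots> = (LINT t:{-R..<R}|lborel. real N * \<bar>emp_cdf N x t - emp_cdf N y t\<bar>)"
    using False assms(1,2)
    by (subst sorted_sum_abs_diff_count)
       (auto simp: emp_cdf_def diff_divide_distrib[symmetric] abs_divide)
  finally show ?thesis by simp
qed simp

lemma ex_sorting_permutation:
  fixes x :: "nat \<Rightarrow> real"
  shows "\<exists>\<tau>. \<tau> permutes {..<N} \<and> (\<forall>j k. j \<le> k \<longrightarrow> k < N \<longrightarrow> x (\<tau> j) \<le> x (\<tau> k))"
proof -
  let ?xs = "map x [0..<N]"
  obtain p where p: "p permutes {..<length ?xs}" "permute_list p ?xs = sort ?xs"
    using mset_eq_permutation[of "sort ?xs" ?xs] by auto
  have "x (p j) = sort ?xs ! j" if "j < N" for j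
    using that p permutes_in_image[OF p(1), of j] by (auto simp flip: p(2) simp: permute_list_nth)
  moreover have "sort ?xs ! j \<le> sort ?xs ! k" if "j \<le> k" "k < N" for j k
    using that by (intro sorted_nth_mono) auto
  ultimately show ?thesis using p(1) by (intro exI[of _ p]) auto
qed

lemma emp_cdf_permute:
  assumes "\<tau> permutes {..<N}"
  shows "emp_cdf N (\<lambda>j. x (\<tau> j)) = emp_cdf N x"
  using sum.permute[OF assms, of "\<lambda>j. indicator {x j..} _ :: real"]
  by (auto simp: emp_cdf_def o_def fun_eq_iff)

section \<open>Sorted arrays and empirical distribution functions\<close>

text \<open>The nearest-point retraction onto the interval. Composing with it coordinatewise extends
  a function from the cube to the whole space and preserves continuity.\<close>

definition clip :: "real \<Rightarrow> real \<Rightarrow> real" where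
  "clip R t = max (- R) (min R t)"

lemma clip_in: "0 \<le> R \<Longrightarrow> clip R t \<in> {-R..R}"
  by (auto simp: clip_def)

lemma clip_id: "t \<in> {-R..R} \<Longrightarrow> clip R t = t"
  by (auto simp: clip_def)

lemma clip_clip [simp]: "clip R (clip R t) = clip R t"
  by (auto simp: clip_def)

lemma abs_clip_diff_le: "\<bar>clip R s - clip R t\<bar> \<le> \<bar>s - t\<bar>"
  by (auto simp: clip_def)

lemma clip_le_iff: "t \<in> {-R..<R} \<Longrightarrow> clip R s \<le> t \<longleftrightarrow> s \<le> t"
  by (auto simp: clip_def)

lemma continuous_on_clip [continuous_intros]:
  "continuous_on A f \<Longrightarrow> continuous_on A (\<lambda>x. clip R (f x))"
  unfolding clip_def by (intro continuous_intros)

text \<open>Clipping moves entries only within the region below \<open>-R\<close> or above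
  \<open>R\<close> up to its boundary point, and thresholds in the half-open interval do not see
  this. Random rows may therefore be clipped when arrays are compared.\<close>

lemma emp_cdf_clip:
  assumes "t \<in> {-R..<R}"
  shows "emp_cdf N (\<lambda>j. clip R (x j)) t = emp_cdf N x t"
proof -
  have "indicator {clip R (x j)..} t = (indicator {x j..} t :: real)" for j
    using clip_le_iff[OF assms, of "x j"] by (simp add: indicator_def)
  then show ?thesis by (simp add: emp_cdf_def)
qed

text \<open>The condition \<open>h_clip\<close> says that \<open>h\<close> is determined by its
  values on the cube, so compactness of the cube gives global boundedness and a global modulus of
  continuity.\<close>

locale cts_potential =
  fixes R :: real and h :: "('n::finite \<Rightarrow> real) \<Rightarrow> real"
  assumes R: "0 < R" and cts: "continuous_on UNIV h"
    and h_clip: "\<And>x. h (\<lambda>i. clip R (x i)) = h x"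
begin

text \<open>Passing to \<open>real^'n\<close> makes compact boxes and a norm available for the next
  two estimates.\<close>

lemma continuous_on_vec: "continuous_on A (\<lambda>v::real^'n. h (\<lambda>i. v $ i))"
  by (rule continuous_on_compose2[OF cts]) (auto intro!: continuous_intros)

lemma clip_vec_in: "(\<chi> i. clip R (x i)) \<in> cbox (\<chi> i. -R) (\<chi> i. R)"
  using clip_in[of R] R by (auto simp: mem_box_cart)

lemma h_vec: "h x = (\<lambda>v::real^'n. h (\<lambda>i. v $ i)) (\<chi> i. clip R (x i))"
  by (simp add: h_clip)

lemma bounded_h: obtains B where "0 \<le> B" "\<And>x. \<bar>h x\<bar> \<le> B"
proof -
  have "bounded ((\<lambda>v::real^'n. h (\<lambda>i. v $ i)) ` cbox (\<chi> i. -R) (\<chi> i. R))"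
    by (intro compact_imp_bounded compact_continuous_image continuous_on_vec compact_cbox)
  then obtain B where B: "\<And>v. v \<in> cbox (\<chi> i. -R) (\<chi> i. R) \<Longrightarrow> \<bar>h (\<lambda>i. v $ i)\<bar> \<le> B"
    by (auto simp: bounded_iff)
  have "\<bar>h x\<bar> \<le> B" for x
    using B[OF clip_vec_in[of x]] h_vec[of x] by simp
  then show ?thesis using that[of "\<bar>B\<bar>"] by (meson abs_ge_self abs_ge_zero order_trans)
qed

text \<open>The distance enters linearly so that the estimate can be summed over the rows of an
  array. Distances below the \<open>d\<close> of uniform continuity cost at most \<open>e\<close>;
  beyond \<open>d\<close> the trivial bound \<open>2 * B\<close> is at most \<open>2 * B / d\<close>
  times the distance.\<close>

lemma modulus:
  assumes "0 < e"
  obtains C where "0 \<le> C" "\<And>x y. \<bar>h x - h y\<bar> \<le> e + C * (\<Sum>i\<in>UNIV. \<bar>x i - y i\<bar>)"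
proof -
  obtain B where B: "0 \<le> B" "\<And>x. \<bar>h x\<bar> \<le> B" using bounded_h by blast
  let ?K = "cbox (\<chi> i. -R) (\<chi> i. R) :: (real^'n) set"
  have "uniformly_continuous_on ?K (\<lambda>v. h (\<lambda>i. v $ i))"
    by (intro compact_uniformly_continuous continuous_on_vec compact_cbox)
  then obtain d where d: "d > 0"
    "\<And>v w. v \<in> ?K \<Longrightarrow> w \<in> ?K \<Longrightarrow> dist w v < d \<Longrightarrow> dist (h (\<lambda>i. w $ i)) (h (\<lambda>i. v $ i)) < e"
    using \<open>0 < e\<close> by (fastforce simp: uniformly_continuous_on_def)
  show ?thesis
  proof (rule that[of "2 * B / d"])
    show "0 \<le> 2 * B / d" using B d by simp
    fix x y :: "'n \<Rightarrow> real"
    let ?S = "\<Sum>i\<in>UNIV. \<bar>x i - y i\<bar>"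
    have S: "0 \<le> ?S" by (intro sum_nonneg) auto
    show "\<bar>h x - h y\<bar> \<le> e + 2 * B / d * ?S"
    proof (cases "?S < d")
      case True
      have "dist (\<chi> i. clip R (x i)) (\<chi> i. clip R (y i)) \<le> (\<Sum>i\<in>UNIV. \<bar>clip R (x i) - clip R (y i)\<bar>)"
        unfolding dist_norm by (rule order_trans[OF norm_le_l1_cart]) simp
      also have "\<dots> \<le> ?S" by (intro sum_mono abs_clip_diff_le)
      finally have "dist (h x) (h y) < e"
        using d(2)[OF clip_vec_in clip_vec_in, of x y] True by (simp add: h_clip)
      then show ?thesis using S B d by (simp add: dist_real_def add_increasing2)
    next
      case False
      have "\<bar>h x - h y\<bar> \<le> 2 * B" using B(2)[of x] B(2)[of y] by linarith
      also have "2 * B * 1 \<le> 2 * B * (?S / d)"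
        using False d B by (intro mult_left_mono) auto
      finally show ?thesis using \<open>0 < e\<close> by (simp add: mult.commute)
    qed
  qed
qed

text \<open>The columns of \<open>w\<close> may be clipped and sorted without changing
  \<open>symm_avg\<close>. Applying one family to both sorted arrays keeps their entries matched, so
  the modulus gives a bound that is the same for every family, and sorted matching turns it into
  distances of distribution functions.\<close>

lemma ln_symm_avg_diff_le:
  assumes mod: "\<And>x y. \<bar>h x - h y\<bar> \<le> e + C * (\<Sum>i\<in>UNIV. \<bar>x i - y i\<bar>)"
    and v: "\<And>i j. j < N \<Longrightarrow> v j i \<in> {-R..R}" "\<And>i j k. j \<le> k \<Longrightarrow> k < N \<Longrightarrow> v j i \<le> v k i"
  shows "\<bar>ln (symm_avg h N w) - ln (symm_avg h N v)\<bar> \<le> real N * (e + C * (\<Sum>i\<in>UNIV.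
           LINT t:{-R..<R}|lborel. \<bar>emp_cdf N (\<lambda>j. w j i) t - emp_cdf N (\<lambda>j. v j i) t\<bar>))"
proof -
  have "\<exists>\<tau>. \<forall>i. \<tau> i permutes {..<N} \<and>
      (\<forall>j k. j \<le> k \<longrightarrow> k < N \<longrightarrow> clip R (w (\<tau> i j) i) \<le> clip R (w (\<tau> i k) i))"
    using ex_sorting_permutation[of N "\<lambda>j. clip R (w j _)"] by (intro choice) auto
  then obtain \<tau> where \<tau>: "\<And>i. \<tau> i permutes {..<N}"
      "\<And>i j k. j \<le> k \<Longrightarrow> k < N \<Longrightarrow> clip R (w (\<tau> i j) i) \<le> clip R (w (\<tau> i k) i)"
    by auto
  define u where "u j i = clip R (w (\<tau> i j) i)" for j i
  have "symm_avg h N w = symm_avg h N (\<lambda>j i. w (\<tau> i j) i)"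
    using \<tau>(1) by (intro symm_avg_permute[symmetric]) (simp add: perm_families_iff)
  also have "\<dots> = symm_avg h N u"
    unfolding u_def by (intro symm_avg_cong) (simp add: h_clip)
  finally have eq: "symm_avg h N w = symm_avg h N u" .
  define c where "c = real N * e + C * (\<Sum>i\<in>UNIV. \<Sum>j<N. \<bar>u j i - v j i\<bar>)"
  have "\<bar>(\<Sum>j<N. h (\<lambda>i. u (s i j) i)) - (\<Sum>j<N. h (\<lambda>i. v (s i j) i))\<bar> \<le> c"
    if s: "s \<in> perm_families N" for s
  proof -
    have "\<bar>(\<Sum>j<N. h (\<lambda>i. u (s i j) i)) - (\<Sum>j<N. h (\<lambda>i. v (s i j) i))\<bar>
        \<le> (\<Sum>j<N. \<bar>h (\<lambda>i. u (s i j) i) - h (\<lambda>i. v (s i j) i)\<bar>)"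
      by (simp add: sum_subtractf[symmetric])
    also have "\<dots> \<le> (\<Sum>j<N. e + C * (\<Sum>i\<in>UNIV. \<bar>u (s i j) i - v (s i j) i\<bar>))"
      by (intro sum_mono mod)
    also have "\<dots> = real N * e + C * (\<Sum>i\<in>UNIV. \<Sum>j<N. \<bar>u (s i j) i - v (s i j) i\<bar>)"
      by (simp add: sum.distrib sum_distrib_left[symmetric] sum.swap[of _ UNIV])
    also have "\<dots> = c"
      using s sum.permute[of "s _" "{..<N}" "\<lambda>j. \<bar>u j _ - v j _\<bar>"]
      by (simp add: c_def perm_families_iff o_def)
    finally show ?thesis .
  qed
  note * = this
  have "ln (symm_avg h N u) \<le> ln (symm_avg h N v) + c" "ln (symm_avg h N v) \<le> ln (symm_avg h N u) + c"
    using * by (intro ln_symm_avg_le; fastforce simp: abs_le_iff)+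
  then have "\<bar>ln (symm_avg h N w) - ln (symm_avg h N v)\<bar> \<le> c"
    by (simp add: eq)
  moreover have "(\<Sum>j<N. \<bar>u j i - v j i\<bar>) = real N *
      (LINT t:{-R..<R}|lborel. \<bar>emp_cdf N (\<lambda>j. w j i) t - emp_cdf N (\<lambda>j. v j i) t\<bar>)" for i
  proof -
    have "(\<Sum>j<N. \<bar>u j i - v j i\<bar>) = real N *
        (LINT t:{-R..<R}|lborel. \<bar>emp_cdf N (\<lambda>j. u j i) t - emp_cdf N (\<lambda>j. v j i) t\<bar>)"
      using v \<tau> R clip_in[of R] by (intro sorted_mean_abs_diff) (auto simp: u_def)
    also have "(LINT t:{-R..<R}|lborel. \<bar>emp_cdf N (\<lambda>j. u j i) t - emp_cdf N (\<lambda>j. v j i) t\<bar>)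
             = (LINT t:{-R..<R}|lborel. \<bar>emp_cdf N (\<lambda>j. w j i) t - emp_cdf N (\<lambda>j. v j i) t\<bar>)"
      unfolding u_def emp_cdf_permute[OF \<tau>(1), of "\<lambda>j. clip R (w j i)"]
      by (intro set_lebesgue_integral_cong) (auto simp: emp_cdf_clip)
    finally show ?thesis .
  qed
  then have "c = real N * (e + C * (\<Sum>i\<in>UNIV.
           LINT t:{-R..<R}|lborel. \<bar>emp_cdf N (\<lambda>j. w j i) t - emp_cdf N (\<lambda>j. v j i) t\<bar>))"
    by (simp add: c_def sum_distrib_left[symmetric] distrib_left mult.left_commute)
  ultimately show ?thesis by simp
qed

end

section \<open>From convergence of moments to L1 convergence of distribution functions\<close>

lemma prob_on_real_distribution: "prob_on R \<mu> \<Longrightarrow> real_distribution \<mu>"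
  by (simp add: prob_on_def real_distribution_def real_distribution_axioms_def)

lemma prob_on_AE: "prob_on R \<mu> \<Longrightarrow> AE x in \<mu>. x \<in> {-R..R}"
  by (subst prob_space.AE_in_set_eq_1) (auto simp: prob_on_def measure_def)

text \<open>Moments control polynomials, and by Weierstrass polynomials approximate \<open>f\<close>
  uniformly on the interval that carries both the entries and \<open>\<mu>\<close>. The error splits
  into three parts of size \<open>r / 3\<close>.\<close>

lemma moments_imp_integral_conv:
  fixes x :: "nat \<Rightarrow> nat \<Rightarrow> real"
  assumes \<mu>: "prob_on R \<mu>" and x: "\<And>N j. j < N \<Longrightarrow> x N j \<in> {-R..R}"
    and mom: "\<And>k::nat. (\<lambda>N. (\<Sum>j<N. x N j ^ k) / real N) \<longlonglongrightarrow> integral\<^sup>L \<mu> (\<lambda>x. x ^ k)"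
    and f: "continuous_on UNIV f"
  shows "(\<lambda>N. (\<Sum>j<N. f (x N j)) / real N) \<longlonglongrightarrow> integral\<^sup>L \<mu> f"
proof -
  interpret real_distribution \<mu> by (rule prob_on_real_distribution) fact
  have int: "integrable \<mu> g" if g: "continuous_on UNIV g" for g :: "real \<Rightarrow> real"
  proof -
    have "bounded (g ` {-R..R})"
      using g by (intro compact_imp_bounded compact_continuous_image) (auto intro: continuous_on_subset)
    then obtain B where "\<And>x. x \<in> {-R..R} \<Longrightarrow> \<bar>g x\<bar> \<le> B"
      unfolding bounded_iff by (auto simp del: atLeastAtMost_iff)
    moreover have "g \<in> borel_measurable borel" using g by (rule borel_measurable_continuous_onI)
    ultimately show ?thesis
      using prob_on_AE[OF \<mu>]
      by (intro integrable_const_bound[where B = B]) (auto simp del: atLeastAtMost_iff elim!: eventually_mono)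
  qed
  show ?thesis
    unfolding LIMSEQ_iff
  proof (intro allI impI)
    fix r :: real assume r: "0 < r"
    obtain g where g: "real_polynomial_function g" "\<And>x. x \<in> {-R..R} \<Longrightarrow> \<bar>f x - g x\<bar> < r / 3"
      using Stone_Weierstrass_real_polynomial_function[of "{-R..R}" f "r/3"] r f
      by (auto intro: continuous_on_subset)
    obtain a n where a: "g = (\<lambda>x. \<Sum>i\<le>n. a i * x ^ i)"
      using g(1) by (auto simp: real_polynomial_function_iff_sum)
    have gc: "continuous_on UNIV g" unfolding a by (intro continuous_intros)
    have "(\<lambda>N. \<Sum>i\<le>n. a i * ((\<Sum>j<N. x N j ^ i) / real N)) \<longlonglongrightarrow> (\<Sum>i\<le>n. a i * integral\<^sup>L \<mu> (\<lambda>x. x ^ i))"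
      by (intro tendsto_intros mom)
    also have "(\<Sum>i\<le>n. a i * integral\<^sup>L \<mu> (\<lambda>x. x ^ i)) = integral\<^sup>L \<mu> g"
      unfolding a by (subst Bochner_Integration.integral_sum) (auto intro!: int continuous_intros)
    also have "(\<lambda>N. \<Sum>i\<le>n. a i * ((\<Sum>j<N. x N j ^ i) / real N)) = (\<lambda>N. (\<Sum>j<N. g (x N j)) / real N)"
      unfolding a
      by (subst sum.swap) (simp add: sum_divide_distrib[symmetric] sum_distrib_left[symmetric])
    finally obtain M where M: "\<And>N. N \<ge> M \<Longrightarrow> \<bar>(\<Sum>j<N. g (x N j)) / real N - integral\<^sup>L \<mu> g\<bar> < r / 3"
      using r unfolding LIMSEQ_iff by (metis real_norm_def zero_less_divide_iff zero_less_numeral)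
    have "\<bar>integral\<^sup>L \<mu> f - integral\<^sup>L \<mu> g\<bar> = \<bar>integral\<^sup>L \<mu> (\<lambda>x. f x - g x)\<bar>"
      using f gc by (simp add: int)
    also have "\<dots> \<le> integral\<^sup>L \<mu> (\<lambda>x. \<bar>f x - g x\<bar>)" by (rule integral_abs_bound)
    also have "\<dots> \<le> integral\<^sup>L \<mu> (\<lambda>x. r / 3)"
      using prob_on_AE[OF \<mu>] g(2) f gc
      by (intro integral_mono_AE int continuous_intros) (auto simp del: atLeastAtMost_iff elim!: eventually_mono intro: less_imp_le)
    also have "\<dots> = r / 3" using prob_space by simp
    finally have 1: "\<bar>integral\<^sup>L \<mu> f - integral\<^sup>L \<mu> g\<bar> \<le> r / 3" .
    have 2: "\<bar>(\<Sum>j<N. f (x N j)) / real N - (\<Sum>j<N. g (x N j)) / real N\<bar> \<le> r / 3" for N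
    proof (cases "N = 0")
      case False
      have "\<bar>(\<Sum>j<N. f (x N j)) - (\<Sum>j<N. g (x N j))\<bar> \<le> (\<Sum>j<N. \<bar>f (x N j) - g (x N j)\<bar>)"
        by (simp add: sum_subtractf[symmetric])
      also have "\<dots> \<le> (\<Sum>j<N. r / 3)"
        using x g(2) by (intro sum_mono less_imp_le) auto
      finally show ?thesis using False by (simp add: diff_divide_distrib[symmetric] abs_divide divide_le_eq mult.commute)
    qed (use r in simp)
    have "\<bar>(\<Sum>j<N. f (x N j)) / real N - integral\<^sup>L \<mu> f\<bar> < r" if "N \<ge> M" for N
      using M[OF that] 1 2[of N] by linarith
    then show "\<exists>M. \<forall>N\<ge>M. norm ((\<Sum>j<N. f (x N j)) / real N - integral\<^sup>L \<mu> f) < r" by auto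
  qed
qed

text \<open>Weak convergence gives pointwise convergence at the continuity points of
  \<open>cdf \<mu>\<close>. The remaining points are countable, hence a null set, and dominated
  convergence on the bounded interval finishes.\<close>

lemma moments_imp_emp_cdf_L1_conv:
  fixes x :: "nat \<Rightarrow> nat \<Rightarrow> real"
  assumes \<mu>: "prob_on R \<mu>" and x: "\<And>N j. j < N \<Longrightarrow> x N j \<in> {-R..R}"
    and mom: "\<And>k::nat. (\<lambda>N. (\<Sum>j<N. x N j ^ k) / real N) \<longlonglongrightarrow> integral\<^sup>L \<mu> (\<lambda>x. x ^ k)"
  shows "(\<lambda>N. LINT t:{-R..<R}|lborel. \<bar>emp_cdf N (x N) t - cdf \<mu> t\<bar>) \<longlonglongrightarrow> 0"
proof -
  interpret real_distribution \<mu> by (rule prob_on_real_distribution) fact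
  \<comment> \<open>The index is shifted because the uniform measure on no points is not a
    probability measure.\<close>
  define M where "M N = distr (uniform_count_measure {..<Suc N}) borel (x (Suc N))" for N
  have mx: "x N \<in> measurable (uniform_count_measure {..<N}) borel" for N
    by (simp add: measurable_def sets_uniform_count_measure space_uniform_count_measure)
  have M: "real_distribution (M N)" for N
    unfolding M_def real_distribution_def real_distribution_axioms_def
    using mx by (auto intro!: prob_space.prob_space_distr prob_space_uniform_count_measure)
  have intM: "integral\<^sup>L (M N) f = (\<Sum>j<Suc N. f (x (Suc N) j)) / real (Suc N)"
    if "f \<in> borel_measurable borel" for N and f :: "real \<Rightarrow> real"
    unfolding M_def using that mx[of "Suc N"]
    by (subst integral_distr) (auto simp: integral_uniform_count_measure)
  have "weak_conv_m M \<mu>"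
  proof (rule integral_cts_step_conv_imp_weak_conv[OF M])
    show "real_distribution \<mu>" by unfold_locales
    fix a b :: real assume ab: "a < b"
    then have c: "continuous_on UNIV (cts_step a b)"
      by (intro uniformly_continuous_imp_continuous cts_step_uniformly_continuous)
    then have "cts_step a b \<in> borel_measurable borel" by (rule borel_measurable_continuous_onI)
    then show "(\<lambda>n. integral\<^sup>L (M n) (cts_step a b)) \<longlonglongrightarrow> integral\<^sup>L \<mu> (cts_step a b)"
      using LIMSEQ_Suc[OF moments_imp_integral_conv[OF \<mu> x mom c]] by (simp only: intM)
  qed
  moreover have "cdf (M N) t = emp_cdf (Suc N) (x (Suc N)) t" for N t
  proof -
    interpret MN: real_distribution "M N" by (rule M)
    have "cdf (M N) t = integral\<^sup>L (M N) (indicator {..t})"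
      by (simp add: cdf_def)
    also have "\<dots> = emp_cdf (Suc N) (x (Suc N)) t"
      by (subst intM) (auto simp: emp_cdf_def indicator_def)
    finally show ?thesis .
  qed
  ultimately have conv: "(\<lambda>N. emp_cdf (Suc N) (x (Suc N)) t) \<longlonglongrightarrow> cdf \<mu> t" if "isCont (cdf \<mu>) t" for t
    using that by (simp add: weak_conv_m_def weak_conv_def)
  have mono: "mono (cdf \<mu>)" by (auto simp: mono_def cdf_nondecreasing)
  have cm [measurable]: "cdf \<mu> \<in> borel_measurable borel" by (rule borel_measurable_mono[OF mono])
  have AE: "AE t in lborel. isCont (cdf \<mu>) t"
    using AE_not_in[OF countable_imp_null_set_lborel[OF mono_ctble_discont[OF mono]]]
    by eventually_elim simp
  have le: "\<bar>emp_cdf N y t - cdf \<mu> t\<bar> \<le> 1" for N y t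
    using emp_cdf_bounds[of N y t] cdf_bounded_prob[of t] cdf_nonneg[of t] by linarith
  have "(\<lambda>N. LINT t:{-R..<R}|lborel. \<bar>emp_cdf (Suc N) (x (Suc N)) t - cdf \<mu> t\<bar>)
     \<longlonglongrightarrow> (LINT t:{-R..<R}|lborel. \<bar>cdf \<mu> t - cdf \<mu> t\<bar>)"
    unfolding set_lebesgue_integral_def
  proof (rule integral_dominated_convergence[where w = "indicator {-R..<R}"])
    show "AE t in lborel. (\<lambda>N. indicator {-R..<R} t *\<^sub>R \<bar>emp_cdf (Suc N) (x (Suc N)) t - cdf \<mu> t\<bar>)
       \<longlonglongrightarrow> indicator {-R..<R} t *\<^sub>R \<bar>cdf \<mu> t - cdf \<mu> t\<bar>"
      using AE by eventually_elim (intro tendsto_intros conv)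
    show "integrable lborel (indicator {-R..<R} :: real \<Rightarrow> real)"
      by (cases "-R \<le> R") (auto intro!: integrable_real_indicator)
  qed (use le in \<open>auto split: split_indicator\<close>)
  then show ?thesis
    by (subst filterlim_sequentially_Suc[symmetric]) (simp add: set_lebesgue_integral_def)
qed

section \<open>Independent rows\<close>

text \<open>Independent centered variables are uncorrelated. The product is padded with the constant
  1 in the other coordinates so that the product formula covers all N of them.\<close>

lemma PiM_expectation_two:
  fixes Y :: "'a \<Rightarrow> real" and N :: nat
  assumes "prob_space \<nu>" and Y: "integrable \<nu> Y" "integral\<^sup>L \<nu> Y = 0"
    and jk: "j < N" "k < N" "j \<noteq> k"
  shows "(\<integral>w. Y (w j) * Y (w k) \<partial>PiM {..<N} (\<lambda>_. \<nu>)) = 0"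
proof -
  interpret prob_space \<nu> by fact
  interpret P: product_sigma_finite "\<lambda>_::nat. \<nu>" by standard
  define f where "f l = (if l \<in> {j, k} then Y else (\<lambda>_. 1))" for l
  have f: "integrable \<nu> (f l)" for l using Y by (simp add: f_def)
  have "(\<Prod>l<N. f l (w l)) = Y (w j) * Y (w k)" for w
  proof -
    have "(\<Prod>l<N. f l (w l)) = (\<Prod>l\<in>{j, k}. f l (w l))"
      using jk by (intro prod.mono_neutral_right) (auto simp: f_def)
    then show ?thesis using jk by (simp add: f_def)
  qed
  then have "(\<integral>w. Y (w j) * Y (w k) \<partial>PiM {..<N} (\<lambda>_. \<nu>)) = (\<Prod>l<N. integral\<^sup>L \<nu> (f l))"
    using P.product_integral_prod[of "{..<N}" f] f by simp
  also have "\<dots> = 0" using jk Y by (auto simp: f_def intro!: bexI[of _ j])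
  finally show ?thesis .
qed

text \<open>The off-diagonal terms of the second moment vanish and each diagonal term is at most 1,
  so the second moment is at most N.\<close>

lemma PiM_expectation_abs_sum_le:
  fixes Y :: "'a \<Rightarrow> real"
  assumes "prob_space \<nu>" and [measurable]: "Y \<in> borel_measurable \<nu>"
    and Y: "\<And>x. \<bar>Y x\<bar> \<le> 1" "integral\<^sup>L \<nu> Y = 0" and "0 < N"
  shows "(\<integral>w. \<bar>\<Sum>j<N. Y (w j)\<bar> \<partial>PiM {..<N} (\<lambda>_. \<nu>)) \<le> sqrt (real N)"
proof -
  interpret prob_space \<nu> by fact
  let ?P = "PiM {..<N} (\<lambda>_. \<nu>)"
  interpret P: prob_space ?P by (intro prob_space_PiM) unfold_locales
  have [measurable]: "(\<lambda>w. Y (w j)) \<in> borel_measurable ?P" if "j < N" for j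
    using that by (intro measurable_compose[OF measurable_component_singleton]) auto
  have intY: "integrable \<nu> Y" using Y by (intro integrable_const_bound[where B=1]) auto
  have le1: "\<bar>Y x * Y y\<bar> \<le> 1" for x y
    using mult_mono[OF Y(1)[of x] Y(1)[of y]] by (simp add: abs_mult)
  have int2: "integrable ?P (\<lambda>w. Y (w j) * Y (w k))" if "j < N" "k < N" for j k
    using that le1 by (intro P.integrable_const_bound[where B=1]) auto
  have sum_le: "\<bar>\<Sum>j<N. Y (w j)\<bar> \<le> real N" for w
    by (rule order_trans[OF sum_abs]) (use sum_bounded_above[of "{..<N}" "\<lambda>j. \<bar>Y (w j)\<bar>" 1] Y(1) in simp)
  have int1: "integrable ?P (\<lambda>w. \<bar>\<Sum>j<N. Y (w j)\<bar>)"
    using sum_le by (intro P.integrable_const_bound[where B="real N"]) auto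
  have sq: "(\<Sum>j<N. Y (w j))\<^sup>2 = (\<Sum>j<N. \<Sum>k<N. Y (w j) * Y (w k))" for w
    by (simp add: power2_eq_square sum_product)
  have intsq: "integrable ?P (\<lambda>w. (\<Sum>j<N. Y (w j))\<^sup>2)"
    unfolding sq using int2 by (intro Bochner_Integration.integrable_sum) auto
  have "(\<integral>w. (\<Sum>j<N. Y (w j))\<^sup>2 \<partial>?P) = (\<Sum>j<N. \<Sum>k<N. \<integral>w. Y (w j) * Y (w k) \<partial>?P)"
  proof -
    have "(\<integral>w. (\<Sum>k<N. Y (w j) * Y (w k)) \<partial>?P) = (\<Sum>k<N. \<integral>w. Y (w j) * Y (w k) \<partial>?P)" if "j < N" for j
      using int2 that by (intro Bochner_Integration.integral_sum) auto
    then show ?thesis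
      unfolding sq using int2
      by (subst Bochner_Integration.integral_sum) (auto intro!: Bochner_Integration.integrable_sum)
  qed
  also have "\<dots> \<le> (\<Sum>j<N. \<Sum>k<N. if j = k then 1 else 0)"
  proof (intro sum_mono)
    fix j k assume "j \<in> {..<N}" "k \<in> {..<N}"
    then show "(\<integral>w. Y (w j) * Y (w k) \<partial>?P) \<le> (if j = k then 1 else 0)"
      using PiM_expectation_two[OF \<open>prob_space \<nu>\<close> intY Y(2), of j N k] le1 int2[of j k]
      by (auto intro!: P.integral_le_const simp: abs_le_iff)
  qed
  finally have var: "(\<integral>w. (\<Sum>j<N. Y (w j))\<^sup>2 \<partial>?P) \<le> real N" by simp
  \<comment> \<open>The inequality of arithmetic and geometric means, with
    \<open>sqrt (real N)\<close> as balancing weight, replaces Cauchy-Schwarz and can be integrated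
    directly.\<close>
  have "\<bar>z\<bar> \<le> (z\<^sup>2 / sqrt (real N) + sqrt (real N)) / 2" for z :: real
  proof -
    have "0 \<le> (\<bar>z\<bar> - sqrt (real N))\<^sup>2 / sqrt (real N)" by simp
    also have "\<dots> = z\<^sup>2 / sqrt (real N) + sqrt (real N) - 2 * \<bar>z\<bar>"
      using \<open>0 < N\<close> by (simp add: power2_diff field_simps)
    finally show ?thesis by simp
  qed
  then have "(\<integral>w. \<bar>\<Sum>j<N. Y (w j)\<bar> \<partial>?P)
      \<le> (\<integral>w. ((\<Sum>j<N. Y (w j))\<^sup>2 / sqrt (real N) + sqrt (real N)) / 2 \<partial>?P)"
    using int1 intsq by (intro integral_mono) auto
  also have "\<dots> = ((\<integral>w. (\<Sum>j<N. Y (w j))\<^sup>2 \<partial>?P) / sqrt (real N) + sqrt (real N)) / 2"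
    using intsq P.prob_space by simp
  also have "\<dots> \<le> (real N / sqrt (real N) + sqrt (real N)) / 2"
    using var by (intro divide_right_mono add_right_mono) auto
  also have "\<dots> = sqrt (real N)" by (simp add: real_div_sqrt)
  finally show ?thesis .
qed

text \<open>At a fixed threshold the deviation is a mean of N independent centered variables bounded
  by 1, with expected size at most \<open>1 / sqrt (real N)\<close>. Fubini integrates this over an
  interval of length \<open>2 * R\<close>; no estimate uniform in the threshold is involved.\<close>

lemma expected_emp_cdf_L1:
  fixes X :: "'a \<Rightarrow> real"
  assumes "prob_space \<nu>" and X[measurable]: "X \<in> borel_measurable \<nu>" and "0 < R" "0 < N"
  defines "D \<equiv> \<lambda>w. LINT t:{-R..<R}|lborel. \<bar>emp_cdf N (\<lambda>j. X (w j)) t - cdf (distr \<nu> borel X) t\<bar>"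
  shows "integrable (PiM {..<N} (\<lambda>_. \<nu>)) D"
    and "(\<integral>w. D w \<partial>PiM {..<N} (\<lambda>_. \<nu>)) \<le> 2 * R / sqrt (real N)"
proof -
  interpret prob_space \<nu> by fact
  let ?P = "PiM {..<N} (\<lambda>_. \<nu>)" and ?F = "cdf (distr \<nu> borel X)"
  interpret P: prob_space ?P by (intro prob_space_PiM) unfold_locales
  interpret F: real_distribution "distr \<nu> borel X"
    by (auto intro!: real_distribution_distr)
  interpret pair_sigma_finite ?P lborel ..
  have [measurable]: "?F \<in> borel_measurable borel"
    by (rule borel_measurable_mono) (auto simp: mono_def F.cdf_nondecreasing)
  have [measurable]: "(\<lambda>w. X (w j)) \<in> borel_measurable ?P" if "j < N" for j
    using that by (intro measurable_compose[OF measurable_component_singleton]) auto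
  define g where "g w t = indicator {-R..<R} t *\<^sub>R \<bar>emp_cdf N (\<lambda>j. X (w j)) t - ?F t\<bar>" for w t
  have le: "\<bar>emp_cdf N y t - ?F t\<bar> \<le> 1" for y t
    using emp_cdf_bounds[of N y t] F.cdf_bounded_prob[of t] F.cdf_nonneg[of t] by linarith
  have "(\<lambda>p. emp_cdf N (\<lambda>j. X (fst p j)) (snd p)) \<in> borel_measurable (?P \<Otimes>\<^sub>M lborel)"
    unfolding emp_cdf_def indicator_def atLeast_iff by measurable
  then have g_meas: "case_prod g \<in> borel_measurable (?P \<Otimes>\<^sub>M lborel)"
    unfolding g_def case_prod_unfold by measurable
  have g_int: "integrable (?P \<Otimes>\<^sub>M lborel) (case_prod g)"
  proof (rule Bochner_Integration.integrable_bound[where f="indicator (space ?P \<times> {-R..<R}) :: _ \<Rightarrow> real"])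
    show "integrable (?P \<Otimes>\<^sub>M lborel) (indicator (space ?P \<times> {-R..<R}) :: _ \<Rightarrow> real)"
      using \<open>0 < R\<close>
      by (intro integrable_real_indicator) (auto simp: lborel.emeasure_pair_measure_Times P.emeasure_space_1)
    show "AE p in ?P \<Otimes>\<^sub>M lborel. norm (case_prod g p) \<le> norm (indicator (space ?P \<times> {-R..<R}) p :: real)"
      using le by (intro AE_I2) (auto simp: g_def space_pair_measure indicator_def)
  qed (rule g_meas)
  have D: "D = (\<lambda>w. \<integral>t. g w t \<partial>lborel)"
    by (simp add: D_def g_def set_lebesgue_integral_def)
  show "integrable ?P D" unfolding D using g_int by (rule integrable_fst)
  have "(\<integral>w. D w \<partial>?P) = (\<integral>t. (\<integral>w. g w t \<partial>?P) \<partial>lborel)"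
    unfolding D by (rule Fubini_integral[symmetric, OF g_int])
  also have "\<dots> \<le> (\<integral>t. indicator {-R..<R} t * (1 / sqrt (real N)) \<partial>lborel)"
  proof (rule integral_mono)
    show "integrable lborel (\<lambda>t. \<integral>w. g w t \<partial>?P)"
      using g_int by (rule integrable_snd)
    show "integrable lborel (\<lambda>t. indicator {-R..<R} t * (1 / sqrt (real N)))"
      using \<open>0 < R\<close> by (intro integrable_mult_left integrable_real_indicator) auto
    fix t
    define Y where "Y x = indicator {X x..} t - ?F t" for x
    have [measurable]: "Y \<in> borel_measurable \<nu>"
      unfolding Y_def indicator_def atLeast_iff by measurable
    have ind: "indicator {X x..} t = (indicator {..t} (X x) :: real)" for x
      by (simp add: indicator_def)
    have "integral\<^sup>L \<nu> Y = (\<integral>x. indicator {X x..} t \<partial>\<nu>) - ?F t"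
      unfolding Y_def
      by (subst Bochner_Integration.integral_diff)
         (auto simp: prob_space ind intro!: integrable_const_bound[where B=1] split: split_indicator)
    also have "(\<integral>x. indicator {X x..} t \<partial>\<nu>) = (\<integral>y. indicator {..t} y \<partial>distr \<nu> borel X :: real)"
      unfolding ind by (subst integral_distr) auto
    also have "\<dots> = ?F t" by (simp add: cdf_def)
    finally have Y0: "integral\<^sup>L \<nu> Y = 0" by simp
    have Y1: "\<bar>Y x\<bar> \<le> 1" for x
      using F.cdf_bounded_prob[of t] F.cdf_nonneg[of t] by (auto simp: Y_def split: split_indicator)
    have "emp_cdf N (\<lambda>j. X (w j)) t - ?F t = (\<Sum>j<N. Y (w j)) / real N" for w
      using \<open>0 < N\<close> by (simp add: Y_def emp_cdf_def sum_subtractf diff_divide_distrib)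
    then have "(\<integral>w. g w t \<partial>?P) = indicator {-R..<R} t * ((\<integral>w. \<bar>\<Sum>j<N. Y (w j)\<bar> \<partial>?P) / real N)"
      by (simp add: g_def abs_divide)
    also have "\<dots> \<le> indicator {-R..<R} t * (sqrt (real N) / real N)"
      using PiM_expectation_abs_sum_le[OF \<open>prob_space \<nu>\<close> _ Y1 Y0 \<open>0 < N\<close>]
      by (intro mult_left_mono divide_right_mono) auto
    also have "sqrt (real N) / real N = 1 / sqrt (real N)"
      using \<open>0 < N\<close> by (simp add: sqrt_divide_self_eq inverse_eq_divide)
    finally show "(\<integral>w. g w t \<partial>?P) \<le> indicator {-R..<R} t * (1 / sqrt (real N))" .
  qed
  also have "\<dots> = 2 * R / sqrt (real N)" using \<open>0 < R\<close> by simp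
  finally show "(\<integral>w. D w \<partial>?P) \<le> 2 * R / sqrt (real N)" .
qed

lemma measurable_symm_avg:
  fixes h :: "('n::finite \<Rightarrow> real) \<Rightarrow> real"
  assumes h: "h \<in> borel_measurable (PiM UNIV (\<lambda>_. borel))"
    and \<nu>: "sets \<nu> = sets (PiM UNIV (\<lambda>_. borel))"
  shows "symm_avg h N \<in> borel_measurable (PiM {..<N} (\<lambda>_. \<nu>))"
proof -
  have "(\<lambda>w. h (\<lambda>i. w (s i j) i)) \<in> borel_measurable (PiM {..<N} (\<lambda>_. \<nu>))"
    if "s \<in> perm_families N" "j < N" for s :: "'n \<Rightarrow> nat \<Rightarrow> nat" and j
  proof (rule measurable_compose[OF _ h], rule measurable_PiM_single')
    fix i
    have m: "(\<lambda>x. x i) \<in> borel_measurable \<nu>"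
      using \<nu> by (simp add: measurable_cong_sets[OF \<nu> refl])
    have "s i j < N" using that permutes_in_image[of "s i" "{..<N}" j] by (auto simp: perm_families_iff)
    then show "(\<lambda>w. w (s i j) i) \<in> borel_measurable (PiM {..<N} (\<lambda>_. \<nu>))"
      by (intro measurable_compose[OF measurable_component_singleton[of "s i j" "{..<N}" "\<lambda>_. \<nu>"] m]) auto
  qed auto
  then show ?thesis
    unfolding symm_avg_def
    by (intro borel_measurable_divide borel_measurable_sum borel_measurable_exp[THEN measurable_compose[rotated]]
        borel_measurable_const) auto
qed

lemma integrable_ln_symm_avg:
  fixes h :: "('n::finite \<Rightarrow> real) \<Rightarrow> real"
  assumes h: "h \<in> borel_measurable (PiM UNIV (\<lambda>_. borel))" "\<And>x. \<bar>h x\<bar> \<le> B"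
    and \<nu>: "prob_space \<nu>" "sets \<nu> = sets (PiM UNIV (\<lambda>_. borel))"
  shows "integrable (PiM {..<N} (\<lambda>_. \<nu>)) (\<lambda>w. ln (symm_avg h N w))"
proof -
  interpret P: prob_space "PiM {..<N} (\<lambda>_. \<nu>)" using \<nu> by (intro prob_space_PiM) auto
  note measurable_symm_avg[OF h(1) \<nu>(2), measurable]
  show ?thesis
    using abs_ln_symm_avg_le[of h B N] h(2) by (intro P.integrable_const_bound[where B="real N * B"]) auto
qed

context cts_potential
begin

lemma measurable_h: "h \<in> borel_measurable (PiM UNIV (\<lambda>_. borel))"
  using borel_measurable_continuous_onI[OF cts]
  by (simp add: measurable_cong_sets[OF sets_PiM_equal_borel refl])

text \<open>The coordinates of one row may depend on each other arbitrarily: sorting compares each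
  column separately, so only the marginals of \<open>\<nu>\<close> matter. The limit concerns the
  difference, and neither sequence is claimed to converge.\<close>

lemma expected_ln_symm_avg_conv:
  assumes "prob_space \<nu>" and \<nu>: "sets \<nu> = sets (PiM UNIV (\<lambda>_. borel))"
    and \<mu>: "\<And>i. distr \<nu> borel (\<lambda>x. x i) = \<mu> i" "\<And>i. prob_on R (\<mu> i)"
    and \<xi>: "approximating R \<mu> \<xi>"
  shows "(\<lambda>N. (\<integral>w. ln (symm_avg h N w) \<partial>PiM {..<N} (\<lambda>_. \<nu>)) / real N
            - ln (symm_avg h N (\<lambda>j i. \<xi> i N j)) / real N) \<longlonglongrightarrow> 0" (is "?d \<longlonglongrightarrow> 0")
proof -
  have \<xi>1: "\<And>i N j. j < N \<Longrightarrow> \<xi> i N j \<in> {-R..R}" "\<And>i N j k. j \<le> k \<Longrightarrow> k < N \<Longrightarrow> \<xi> i N j \<le> \<xi> i N k"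
    and \<xi>2: "\<And>i k. (\<lambda>N. (\<Sum>j<N. (\<xi> i N j) ^ k) / real N) \<longlonglongrightarrow> integral\<^sup>L (\<mu> i) (\<lambda>x. x ^ k)"
    using \<xi> by (auto simp: approximating_def)
  define E where "E i N = (LINT t:{-R..<R}|lborel. \<bar>emp_cdf N (\<xi> i N) t - cdf (\<mu> i) t\<bar>)" for i N
  have E: "E i \<longlonglongrightarrow> 0" for i
    unfolding E_def using \<xi>1(1) \<xi>2 by (intro moments_imp_emp_cdf_L1_conv \<mu>) auto
  have m [measurable]: "(\<lambda>x. x i) \<in> borel_measurable \<nu>" for i
    by (simp add: measurable_cong_sets[OF \<nu> refl])
  \<comment> \<open>The triangle inequality passes through \<open>cdf (\<mu> i)\<close>: the first
    term is the expected sampling error, the second the error of the given array. The constants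
    \<open>e\<close> and \<open>C\<close> are fixed before N grows.\<close>
  have bound: "\<bar>?d N\<bar> \<le> e + C * (\<Sum>i\<in>UNIV. 2 * R / sqrt (real N) + E i N)"
    if N: "0 < N" and C: "0 \<le> C" "\<And>x y. \<bar>h x - h y\<bar> \<le> e + C * (\<Sum>i\<in>UNIV. \<bar>x i - y i\<bar>)" for N e C
  proof -
    let ?P = "PiM {..<N} (\<lambda>_. \<nu>)" and ?v = "\<lambda>j i. \<xi> i N j"
    interpret P: prob_space ?P using assms by (intro prob_space_PiM) auto
    define D where "D i w = (LINT t:{-R..<R}|lborel. \<bar>emp_cdf N (\<lambda>j. w j i) t - cdf (\<mu> i) t\<bar>)"
      for i and w :: "nat \<Rightarrow> 'n \<Rightarrow> real"
    have D: "integrable ?P (D i)" "(\<integral>w. D i w \<partial>?P) \<le> 2 * R / sqrt (real N)" for i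
      using expected_emp_cdf_L1[OF \<open>prob_space \<nu>\<close> m[of i] R N]
      unfolding D_def \<mu>(1)[of i, symmetric] by auto
    have int: "integrable ?P (\<lambda>w. ln (symm_avg h N w))"
    proof -
      obtain B where "\<And>x. \<bar>h x\<bar> \<le> B" using bounded_h by blast
      then show ?thesis using \<open>prob_space \<nu>\<close> \<nu> by (rule integrable_ln_symm_avg[OF measurable_h])
    qed
    have tri: "(LINT t:{-R..<R}|lborel. \<bar>emp_cdf N (\<lambda>j. w j i) t - emp_cdf N (\<lambda>j. ?v j i) t\<bar>)
             \<le> D i w + E i N" for w i
    proof -
      interpret F: real_distribution "\<mu> i" by (rule prob_on_real_distribution[OF \<mu>(2)])
      have [measurable]: "cdf (\<mu> i) \<in> borel_measurable borel"
        by (rule borel_measurable_mono) (auto simp: mono_def F.cdf_nondecreasing)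
      have le: "\<bar>emp_cdf N y t - cdf (\<mu> i) t\<bar> \<le> 1" "\<bar>emp_cdf N y t - emp_cdf N z t\<bar> \<le> 1" for y z t
        using emp_cdf_bounds[of N y t] emp_cdf_bounds[of N z t]
          F.cdf_bounded_prob[of t] F.cdf_nonneg[of t] by linarith+
      have "(LINT t:{-R..<R}|lborel. \<bar>emp_cdf N (\<lambda>j. w j i) t - emp_cdf N (\<lambda>j. ?v j i) t\<bar>)
         \<le> (LINT t:{-R..<R}|lborel. \<bar>emp_cdf N (\<lambda>j. w j i) t - cdf (\<mu> i) t\<bar> + \<bar>emp_cdf N (\<xi> i N) t - cdf (\<mu> i) t\<bar>)"
        using le by (intro set_integral_mono set_integral_add set_integrable_bounded_lborel[where B=1]) auto
      also have "\<dots> = D i w + E i N"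
        unfolding D_def E_def using le
        by (intro set_integral_add set_integrable_bounded_lborel[where B=1]) auto
      finally show ?thesis .
    qed
    have "\<bar>ln (symm_avg h N w) - ln (symm_avg h N ?v)\<bar> \<le> real N * (e + C * (\<Sum>i\<in>UNIV. D i w + E i N))" for w
    proof -
      have "\<bar>ln (symm_avg h N w) - ln (symm_avg h N ?v)\<bar> \<le> real N * (e + C * (\<Sum>i\<in>UNIV.
           LINT t:{-R..<R}|lborel. \<bar>emp_cdf N (\<lambda>j. w j i) t - emp_cdf N (\<lambda>j. ?v j i) t\<bar>))"
        using \<xi>1 C by (intro ln_symm_avg_diff_le) auto
      also have "\<dots> \<le> real N * (e + C * (\<Sum>i\<in>UNIV. D i w + E i N))"
        using C(1) tri by (intro mult_left_mono add_left_mono sum_mono) auto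
      finally show ?thesis .
    qed
    then have "(\<integral>w. \<bar>ln (symm_avg h N w) - ln (symm_avg h N ?v)\<bar> \<partial>?P)
            \<le> (\<integral>w. real N * (e + C * (\<Sum>i\<in>UNIV. D i w + E i N)) \<partial>?P)"
      using int D by (intro integral_mono) (auto intro!: Bochner_Integration.integrable_sum)
    also have "\<dots> = real N * (e + C * (\<Sum>i\<in>UNIV. (\<integral>w. D i w \<partial>?P) + E i N))"
      using D P.prob_space by (simp add: Bochner_Integration.integral_sum)
    also have "\<dots> \<le> real N * (e + C * (\<Sum>i\<in>UNIV. 2 * R / sqrt (real N) + E i N))"
      using D C(1) by (intro mult_left_mono add_left_mono sum_mono add_right_mono) auto
    finally have *: "(\<integral>w. \<bar>ln (symm_avg h N w) - ln (symm_avg h N ?v)\<bar> \<partial>?P)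
      \<le> real N * (e + C * (\<Sum>i\<in>UNIV. 2 * R / sqrt (real N) + E i N))" .
    have "?d N = (\<integral>w. ln (symm_avg h N w) - ln (symm_avg h N ?v) \<partial>?P) / real N"
      using int P.prob_space by (simp add: diff_divide_distrib)
    then have "\<bar>?d N\<bar> \<le> (\<integral>w. \<bar>ln (symm_avg h N w) - ln (symm_avg h N ?v)\<bar> \<partial>?P) / real N"
      by (simp add: abs_divide divide_right_mono integral_abs_bound)
    also have "\<dots> \<le> e + C * (\<Sum>i\<in>UNIV. 2 * R / sqrt (real N) + E i N)"
      using * N by (simp add: divide_le_eq mult.commute)
    finally show ?thesis .
  qed
  show ?thesis
    unfolding LIMSEQ_iff
  proof (intro allI impI)
    fix r :: real assume r: "0 < r"
    obtain C where C: "0 \<le> C" "\<And>x y. \<bar>h x - h y\<bar> \<le> r / 2 + C * (\<Sum>i\<in>UNIV. \<bar>x i - y i\<bar>)"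
      using modulus[of "r/2"] r by auto
    have "(\<lambda>N. 2 * R / sqrt (real N)) \<longlonglongrightarrow> 0"
      by (intro real_tendsto_divide_at_top[OF tendsto_const] filterlim_compose[OF sqrt_at_top filterlim_real_sequentially])
    then have "(\<lambda>N. C * (\<Sum>i\<in>(UNIV::'n set). 2 * R / sqrt (real N) + E i N)) \<longlonglongrightarrow> C * (\<Sum>i\<in>(UNIV::'n set). 0 + 0)"
      using E by (intro tendsto_intros)
    then have "\<forall>\<^sub>F N in sequentially. C * (\<Sum>i\<in>(UNIV::'n set). 2 * R / sqrt (real N) + E i N) < r / 2"
      using r by (intro order_tendstoD(2)[where y=0]) auto
    then have "\<forall>\<^sub>F N in sequentially. norm (?d N - 0) < r"
      using eventually_gt_at_top[of 0]
    proof eventually_elim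
      case (elim N)
      then show ?case using bound[OF elim(2) C] r by simp
    qed
    then show "\<exists>M. \<forall>N\<ge>M. norm (?d N - 0) < r" by (simp add: eventually_sequentially)
  qed
qed

end

section \<open>Permutation invariance and Jensen bounds\<close>

text \<open>It suffices to compare boxes, where the integral factors. The lemma serves twice: over
  the coordinates for the density of \<pi>, and over the rows for the tilted law of a whole
  array.\<close>

lemma PiM_density:
  fixes M :: "'i \<Rightarrow> 'a measure"
  assumes I: "finite I" and M: "\<And>i. sigma_finite_measure (M i)"
    and f[measurable]: "\<And>i. f i \<in> borel_measurable (M i)"
    and fM: "\<And>i. sigma_finite_measure (density (M i) (f i))"
  shows "PiM I (\<lambda>i. density (M i) (f i)) = density (PiM I M) (\<lambda>x. \<Prod>i\<in>I. f i (x i))"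
proof -
  interpret D: product_sigma_finite "\<lambda>i. density (M i) (f i)"
    using fM by (simp add: product_sigma_finite_def)
  interpret product_sigma_finite M
    using M by (simp add: product_sigma_finite_def)
  have [measurable]: "(\<lambda>x. f i (x i)) \<in> borel_measurable (PiM I M)" if "i \<in> I" for i
    using that by (intro measurable_compose[OF measurable_component_singleton[of i I M] f])
  show ?thesis
  proof (rule D.PiM_eqI[symmetric, OF I])
    show "sets (density (PiM I M) (\<lambda>x. \<Prod>i\<in>I. f i (x i))) = sets (PiM I (\<lambda>i. density (M i) (f i)))"
      by (simp cong: sets_PiM_cong)
    fix A assume "\<And>i. i \<in> I \<Longrightarrow> A i \<in> sets (density (M i) (f i))"
    then have A[measurable]: "A i \<in> sets (M i)" if "i \<in> I" for i using that by simp
    have "emeasure (density (PiM I M) (\<lambda>x. \<Prod>i\<in>I. f i (x i))) (PiE I A)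
        = (\<integral>\<^sup>+x. (\<Prod>i\<in>I. f i (x i)) * indicator (PiE I A) x \<partial>PiM I M)"
      using I A by (subst emeasure_density) (auto intro!: sets_PiM_I_finite)
    also have "\<dots> = (\<integral>\<^sup>+x. (\<Prod>i\<in>I. f i (x i) * indicator (A i) (x i)) \<partial>PiM I M)"
      using I by (intro nn_integral_cong)
        (auto simp: prod.distrib space_PiM indicator_def PiE_iff split: if_splits)
    also have "\<dots> = (\<Prod>i\<in>I. \<integral>\<^sup>+x. f i x * indicator (A i) x \<partial>M i)"
      using I by (intro product_nn_integral_prod) auto
    also have "\<dots> = (\<Prod>i\<in>I. emeasure (density (M i) (f i)) (A i))"
      by (intro prod.cong) (auto simp: emeasure_density)
    finally show "emeasure (density (PiM I M) (\<lambda>x. \<Prod>i\<in>I. f i (x i))) (PiE I A)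
        = (\<Prod>i\<in>I. emeasure (density (M i) (f i)) (A i))" .
  qed
qed

text \<open>All entries are independent under the product over pairs. Grouping them by row keeps the
  groups independent, and each row has the product law.\<close>

lemma distr_PiM_curry:
  fixes \<mu> :: "'n::finite \<Rightarrow> 'a measure"
  assumes \<mu>: "\<And>i. prob_space (\<mu> i)" and "L \<noteq> {}"
  shows "distr (PiM (UNIV \<times> L) (\<lambda>p. \<mu> (fst p))) (PiM L (\<lambda>_. PiM UNIV \<mu>)) (\<lambda>x. \<lambda>j\<in>L. \<lambda>i. x (i, j))
       = PiM L (\<lambda>_. PiM UNIV \<mu>)"
proof -
  let ?M = "\<lambda>p. \<mu> (fst p)" and ?K = "UNIV \<times> L"
  interpret prob_space "PiM ?K ?M" using \<mu> by (intro prob_space_PiM)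
  have K: "?K \<noteq> {}" using \<open>L \<noteq> {}\<close> by auto
  have "distr (PiM ?K ?M) (PiM ?K ?M) (\<lambda>x. restrict x ?K) = distr (PiM ?K ?M) (PiM ?K ?M) (\<lambda>x. x)"
    by (intro distr_cong) (auto simp: space_PiM)
  also have "\<dots> = PiM ?K (\<lambda>p. distr (PiM ?K ?M) (?M p) (\<lambda>x. x p))"
    using \<mu> distr_PiM_component[of ?K ?M] by (auto intro!: PiM_cong)
  finally have "indep_vars ?M (\<lambda>p x. x p) ?K"
    by (subst indep_vars_iff_distr_eq_PiM'[OF K]) auto
  then have "indep_vars (\<lambda>j. PiM (UNIV \<times> {j}) ?M) (\<lambda>j x. restrict (\<lambda>p. x p) (UNIV \<times> {j})) L"
    by (rule indep_vars_restrict) (auto simp: disjoint_family_on_def)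
  then have "indep_vars (\<lambda>_. PiM UNIV \<mu>) (\<lambda>j x. (\<lambda>i. restrict (\<lambda>p. x p) (UNIV \<times> {j}) (i, j))) L"
  proof (rule indep_vars_compose2)
    fix j
    show "(\<lambda>z i. z (i, j)) \<in> measurable (PiM (UNIV \<times> {j}) ?M) (PiM UNIV \<mu>)"
      by (rule measurable_PiM_single')
         (auto simp: space_PiM PiE_iff
              intro!: measurable_component_singleton[where M="\<lambda>p. \<mu> (fst p)", of "(_, _)", simplified])
  qed
  then have ind: "indep_vars (\<lambda>_. PiM UNIV \<mu>) (\<lambda>j x. (\<lambda>i. x (i, j))) L"
    by simp
  have meas: "random_variable (PiM UNIV \<mu>) (\<lambda>x i. x (i, j))" if "j \<in> L" for j
    using ind that by (auto simp: indep_vars_def)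
  have "distr (PiM ?K ?M) (PiM UNIV \<mu>) (\<lambda>x i. x (i, j)) = PiM UNIV \<mu>" if "j \<in> L" for j
    using distr_PiM_reindex[of ?K ?M "\<lambda>i. (i, j)" UNIV] \<mu> that by (auto simp: inj_on_def restrict_UNIV)
  then show ?thesis
    using ind meas by (subst (asm) indep_vars_iff_distr_eq_PiM'[OF \<open>L \<noteq> {}\<close>]) (auto cong: PiM_cong)
qed

text \<open>Over pairs, permuting the columns is reindexing by the injection that sends
  \<open>(i, j)\<close> to \<open>(i, s i j)\<close>. It keeps the first component and therefore the
  factor attached to each index. Currying transports this to arrays of rows.\<close>

lemma distr_PiM_permute:
  fixes \<mu> :: "'n::finite \<Rightarrow> 'a measure" and N :: nat
  assumes \<mu>: "\<And>i. prob_space (\<mu> i)" and s: "s \<in> perm_families N" and "0 < N"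
  defines "Q \<equiv> PiM {..<N} (\<lambda>_. PiM UNIV \<mu>)"
  shows "(\<lambda>w. \<lambda>j\<in>{..<N}. \<lambda>i. w (s i j) i) \<in> measurable Q Q"
    and "distr Q Q (\<lambda>w. \<lambda>j\<in>{..<N}. \<lambda>i. w (s i j) i) = Q"
proof -
  let ?M = "\<lambda>p. \<mu> (fst p)" and ?K = "UNIV \<times> {..<N} :: ('n \<times> nat) set"
  let ?P = "PiM ?K ?M" and ?T = "\<lambda>w. \<lambda>j\<in>{..<N}. \<lambda>i. w (s i j) i"
  let ?c = "\<lambda>x. \<lambda>j\<in>{..<N}. \<lambda>i. x (i, j)" and ?f = "\<lambda>p. (fst p, s (fst p) (snd p))"
  have sp: "s i permutes {..<N}" for i using s by (simp add: perm_families_iff)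
  have lt: "s i j < N \<longleftrightarrow> j < N" for i j using permutes_in_image[OF sp, of i j] by simp
  show T: "?T \<in> measurable Q Q"
    unfolding Q_def
  proof (intro measurable_restrict measurable_PiM_single')
    fix j i assume "j \<in> {..<N}"
    then show "(\<lambda>w. w (s i j) i) \<in> measurable (PiM {..<N} (\<lambda>_. PiM UNIV \<mu>)) (\<mu> i)"
      by (intro measurable_compose[OF measurable_component_singleton[of "s i j" "{..<N}" "\<lambda>_. PiM UNIV \<mu>"]
            measurable_component_singleton]) (auto simp: lt)
  qed (auto simp: space_PiM PiE_iff lt)
  have cP: "distr ?P Q ?c = Q"
    unfolding Q_def using \<open>0 < N\<close> by (intro distr_PiM_curry \<mu>) auto
  have c: "?c \<in> measurable ?P Q"
    unfolding Q_def
    by (intro measurable_restrict measurable_PiM_single')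
       (auto simp: space_PiM PiE_iff
              intro!: measurable_component_singleton[where M="\<lambda>p. \<mu> (fst p)", of "(_, _)", simplified])
  have "distr ?P (PiM ?K (\<lambda>p. ?M (?f p))) (\<lambda>x. \<lambda>p\<in>?K. x (?f p)) = PiM ?K (\<lambda>p. ?M (?f p))"
    using \<mu> lt permutes_inj[OF sp] by (intro distr_PiM_reindex) (auto simp: inj_on_def inj_def)
  then have rP: "distr ?P ?P (\<lambda>x. \<lambda>p\<in>?K. x (?f p)) = ?P" by simp
  have r: "(\<lambda>x. \<lambda>p\<in>?K. x (?f p)) \<in> measurable ?P ?P"
    by (intro measurable_restrict)
       (auto simp: lt intro!: measurable_component_singleton[where M="\<lambda>p. \<mu> (fst p)", of "(_, _)", simplified])
  have "distr Q Q ?T = distr (distr ?P Q ?c) Q ?T" by (simp add: cP)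
  also have "\<dots> = distr ?P Q (?T \<circ> ?c)" by (rule distr_distr[OF T c])
  also have "\<dots> = distr ?P Q (?c \<circ> (\<lambda>x. \<lambda>p\<in>?K. x (?f p)))"
    by (intro distr_cong refl) (auto simp: fun_eq_iff lt restrict_def)
  also have "\<dots> = distr (distr ?P ?P (\<lambda>x. \<lambda>p\<in>?K. x (?f p))) Q ?c" by (rule distr_distr[OF c r, symmetric])
  also have "\<dots> = Q" by (simp only: rP cP)
  finally show "distr Q Q ?T = Q" .
qed

locale product_marginals =
  fixes \<mu> :: "'n::finite \<Rightarrow> real measure"
  assumes prob: "\<And>i. prob_space (\<mu> i)" and sets_\<mu>: "\<And>i. sets (\<mu> i) = sets borel"
begin

definition Q :: "nat \<Rightarrow> (nat \<Rightarrow> 'n \<Rightarrow> real) measure" where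
  "Q N = PiM {..<N} (\<lambda>_. PiM UNIV \<mu>)"

lemma prob_space_prod: "prob_space (PiM UNIV \<mu>)"
  by (intro prob_space_PiM prob)

lemma prob_space_Q: "prob_space (Q N)"
  unfolding Q_def by (intro prob_space_PiM prob_space_prod)

lemma sets_prod: "sets (PiM UNIV \<mu>) = sets (PiM UNIV (\<lambda>_. borel))"
  by (intro sets_PiM_cong) (simp_all add: sets_\<mu>)

lemma measurable_symm_avg_Q:
  assumes "g \<in> borel_measurable (PiM UNIV (\<lambda>_. borel))"
  shows "symm_avg g N \<in> borel_measurable (Q N)"
  unfolding Q_def by (rule measurable_symm_avg[OF assms sets_prod])

lemma measurable_column:
  assumes "g \<in> borel_measurable (PiM UNIV (\<lambda>_. borel))" "j < N"
  shows "(\<lambda>w. g (w j)) \<in> borel_measurable (Q N)"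
  unfolding Q_def using assms
  by (intro measurable_compose[OF measurable_component_singleton[of j "{..<N}" "\<lambda>_. PiM UNIV \<mu>"]])
     (auto simp: measurable_cong_sets[OF sets_prod refl])

text \<open>The exponential is the summand of \<open>symm_avg\<close> for the identity family. The
  other summands arise from it by measure-preserving column permutations, under which
  \<open>F (symm_avg g N w)\<close> is invariant, so all of them contribute equally.\<close>

lemma symmetrize:
  assumes g: "g \<in> borel_measurable (PiM UNIV (\<lambda>_. borel))" and [measurable]: "F \<in> borel_measurable borel"
    and N: "0 < N"
    and int: "integrable (Q N) (\<lambda>w. exp (\<Sum>j<N. g (w j)) * F (symm_avg g N w))"
  shows "integrable (Q N) (\<lambda>w. symm_avg g N w * F (symm_avg g N w))"
    and "(\<integral>w. symm_avg g N w * F (symm_avg g N w) \<partial>Q N)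
       = (\<integral>w. exp (\<Sum>j<N. g (w j)) * F (symm_avg g N w) \<partial>Q N)"
proof -
  define f where "f w = exp (\<Sum>j<N. g (w j)) * F (symm_avg g N w)" for w
  define T where "T s w = (\<lambda>j\<in>{..<N}. \<lambda>i. w (s i j) i)" for s :: "'n \<Rightarrow> nat \<Rightarrow> nat" and w :: "nat \<Rightarrow> 'n \<Rightarrow> real"
  note measurable_symm_avg_Q[OF g, measurable] measurable_column[OF g, measurable]
  have f[measurable]: "f \<in> borel_measurable (Q N)" unfolding f_def by measurable
  have T: "T s \<in> measurable (Q N) (Q N)" "distr (Q N) (Q N) (T s) = Q N" if "s \<in> perm_families N" for s
    using distr_PiM_permute[OF prob that N] unfolding T_def Q_def by auto
  have avg: "symm_avg g N (T s w) = symm_avg g N w" if s: "s \<in> perm_families N" for s w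
  proof -
    have "symm_avg g N (T s w) = symm_avg g N (\<lambda>j i. w (s i j) i)"
    proof (rule symm_avg_cong)
      fix r :: "'n \<Rightarrow> nat \<Rightarrow> nat" and j assume "r \<in> perm_families N" "j < N"
      then have "r i j < N" for i
        using permutes_in_image[of "r i" "{..<N}" j] by (auto simp: perm_families_iff)
      then show "g (\<lambda>i. T s w (r i j) i) = g (\<lambda>i. w (s i (r i j)) i)" by (simp add: T_def)
    qed
    also have "\<dots> = symm_avg g N w" using s by (rule symm_avg_permute)
    finally show ?thesis .
  qed
  have eq: "symm_avg g N w * F (symm_avg g N w) = (\<Sum>s\<in>perm_families N. f (T s w)) / fact N ^ CARD('n)" for w
  proof -
    have "f (T s w) = exp (\<Sum>j<N. g (\<lambda>i. w (s i j) i)) * F (symm_avg g N w)" if "s \<in> perm_families N" for s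
      unfolding f_def avg[OF that] by (simp add: T_def)
    then show ?thesis by (simp add: symm_avg_def[of g N w] sum_distrib_right[symmetric])
  qed
  have intT: "integrable (Q N) (\<lambda>w. f (T s w))" if "s \<in> perm_families N" for s
    using int[folded f_def] T[OF that] integrable_distr_eq[OF T(1)[OF that] f] by simp
  have intgT: "(\<integral>w. f (T s w) \<partial>Q N) = (\<integral>w. f w \<partial>Q N)" if "s \<in> perm_families N" for s
    using T[OF that] integral_distr[OF T(1)[OF that] f] by simp
  show "integrable (Q N) (\<lambda>w. symm_avg g N w * F (symm_avg g N w))"
    unfolding eq using intT by auto
  have "(\<integral>w. symm_avg g N w * F (symm_avg g N w) \<partial>Q N)
      = (\<Sum>s\<in>(perm_families N :: ('n \<Rightarrow> _) set). \<integral>w. f (T s w) \<partial>Q N) / fact N ^ CARD('n)"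
    unfolding eq using intT by (simp add: Bochner_Integration.integral_sum)
  also have "\<dots> = (\<integral>w. f w \<partial>Q N)"
    by (simp add: intgT card_perm_families)
  finally show "(\<integral>w. symm_avg g N w * F (symm_avg g N w) \<partial>Q N)
       = (\<integral>w. exp (\<Sum>j<N. g (w j)) * F (symm_avg g N w) \<partial>Q N)" by (simp add: f_def)
qed

lemma expected_symm_avg:
  assumes g: "g \<in> borel_measurable (PiM UNIV (\<lambda>_. borel))" and N: "0 < N"
    and int: "integrable (PiM UNIV \<mu>) (\<lambda>x. exp (g x))"
  shows "integrable (Q N) (symm_avg g N)"
    and "(\<integral>w. symm_avg g N w \<partial>Q N) = (\<integral>x. exp (g x) \<partial>PiM UNIV \<mu>) ^ N"
proof -
  interpret prob_space "PiM UNIV \<mu>" by (rule prob_space_prod)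
  interpret product_sigma_finite "\<lambda>_::nat. PiM UNIV \<mu>" ..
  \<comment> \<open>The factor 1 instantiates \<open>F\<close> by a constant function; independence
    of the rows then factors the exponential.\<close>
  have 1: "integrable (Q N) (\<lambda>w. exp (\<Sum>j<N. g (w j)) * 1)"
    using product_integrable_prod[of "{..<N}" "\<lambda>_ x. exp (g x)"] int
    by (simp add: exp_sum Q_def)
  show "integrable (Q N) (symm_avg g N)" "(\<integral>w. symm_avg g N w \<partial>Q N) = (\<integral>x. exp (g x) \<partial>PiM UNIV \<mu>) ^ N"
    using symmetrize[OF g _ N 1] product_integral_prod[of "{..<N}" "\<lambda>_ x. exp (g x)"] int
    by (simp_all add: exp_sum Q_def)
qed

text \<open>Jensen's inequality in tangent form: \<open>ln s \<le> s - 1\<close> at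
  \<open>s = symm_avg g N w / Z ^ N\<close>. An upper bound \<open>Z\<close> is enough, which
  matters because the integral can fall below e^P(h) where a density vanishes.\<close>

lemma expected_ln_symm_avg_le:
  assumes g: "g \<in> borel_measurable (PiM UNIV (\<lambda>_. borel))" and N: "0 < N"
    and int: "integrable (PiM UNIV \<mu>) (\<lambda>x. exp (g x))"
    and Z: "(\<integral>x. exp (g x) \<partial>PiM UNIV \<mu>) \<le> Z" "0 < Z"
    and intln: "integrable (Q N) (\<lambda>w. ln (symm_avg g N w))"
  shows "(\<integral>w. ln (symm_avg g N w) \<partial>Q N) \<le> real N * ln Z"
proof -
  interpret prob_space "Q N" by (rule prob_space_Q)
  note S = expected_symm_avg[OF g N int]
  have "ln (symm_avg g N w) \<le> symm_avg g N w / Z ^ N - 1 + real N * ln Z" for w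
    using ln_le_minus_one[of "symm_avg g N w / Z ^ N"] symm_avg_pos[of g N w] Z(2)
    by (simp add: ln_div ln_realpow)
  then have "(\<integral>w. ln (symm_avg g N w) \<partial>Q N) \<le> (\<integral>w. symm_avg g N w / Z ^ N - 1 + real N * ln Z \<partial>Q N)"
    using S(1) intln by (intro integral_mono) auto
  also have "\<dots> = (\<integral>x. exp (g x) \<partial>PiM UNIV \<mu>) ^ N / Z ^ N - 1 + real N * ln Z"
    using S prob_space by simp
  also have "(\<integral>x. exp (g x) \<partial>PiM UNIV \<mu>) ^ N / Z ^ N \<le> 1"
    using Z by (simp add: divide_le_eq power_mono)
  finally show ?thesis by simp
qed

text \<open>N independent tilted rows have density exp of the row sum with respect to
  \<open>Q N\<close>, and \<open>symmetrize\<close> replaces this density by S. The resulting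
  expectation of S ln S is at least that of S - 1, which is 0. Boundedness of \<open>g\<close>
  supplies all integrability.\<close>

lemma expected_ln_symm_avg_tilted_ge:
  assumes g: "g \<in> borel_measurable (PiM UNIV (\<lambda>_. borel))" and N: "0 < N"
    and B: "\<And>x. \<bar>g x\<bar> \<le> B"
    and one: "(\<integral>x. exp (g x) \<partial>PiM UNIV \<mu>) = 1"
  shows "0 \<le> (\<integral>w. ln (symm_avg g N w) \<partial>PiM {..<N} (\<lambda>_. density (PiM UNIV \<mu>) (\<lambda>x. ennreal (exp (g x)))))"
proof -
  let ?\<pi> = "PiM UNIV \<mu>" and ?S = "symm_avg g N"
  interpret p: prob_space ?\<pi> by (rule prob_space_prod)
  interpret prob_space "Q N" by (rule prob_space_Q)
  have g'[measurable]: "g \<in> borel_measurable ?\<pi>"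
    using g by (simp add: measurable_cong_sets[OF sets_prod refl])
  note measurable_symm_avg_Q[OF g, measurable] measurable_column[OF g, measurable]
  have "exp (g x) \<le> exp B" for x using B[of x] by simp
  then have int: "integrable ?\<pi> (\<lambda>x. exp (g x))"
    by (intro p.integrable_const_bound[where B="exp B"]) auto
  have "(\<Sum>j<N. g (w j)) \<le> real N * B" for w
    using sum_bounded_above[of "{..<N}" "\<lambda>j. g (w j)" B] B by (auto simp: abs_le_iff)
  then have eB: "exp (\<Sum>j<N. g (w j)) \<le> exp (real N * B)" for w
    by simp
  have ln: "\<bar>ln (?S w)\<bar> \<le> real N * B" for w
    using B by (rule abs_ln_symm_avg_le)
  have "\<bar>exp (\<Sum>j<N. g (w j)) * ln (?S w)\<bar> \<le> exp (real N * B) * (real N * B)" for w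
    using mult_mono[OF eB ln] by (simp add: abs_mult)
  then have int2: "integrable (Q N) (\<lambda>w. exp (\<Sum>j<N. g (w j)) * ln (?S w))"
    by (intro integrable_const_bound[where B="exp (real N * B) * (real N * B)"]) auto
  note S = expected_symm_avg[OF g N int] and SF = symmetrize[OF g borel_measurable_ln[OF measurable_ident, unfolded id_def] N int2]
  have "prob_space (density ?\<pi> (\<lambda>x. ennreal (exp (g x))))"
    by (intro prob_spaceI) (simp add: emeasure_density nn_integral_eq_integral[OF int] one)
  then have "sigma_finite_measure (density ?\<pi> (\<lambda>x. ennreal (exp (g x))))"
    by (simp add: prob_space_imp_sigma_finite)
  then have "PiM {..<N} (\<lambda>_. density ?\<pi> (\<lambda>x. ennreal (exp (g x))))
      = density (Q N) (\<lambda>w. \<Prod>j<N. ennreal (exp (g (w j))))"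
    unfolding Q_def by (intro PiM_density) (auto intro: p.sigma_finite_measure_axioms)
  also have "\<dots> = density (Q N) (\<lambda>w. ennreal (exp (\<Sum>j<N. g (w j))))"
    by (simp add: exp_sum prod_ennreal)
  finally have "(\<integral>w. ln (?S w) \<partial>PiM {..<N} (\<lambda>_. density ?\<pi> (\<lambda>x. ennreal (exp (g x)))))
     = (\<integral>w. exp (\<Sum>j<N. g (w j)) * ln (?S w) \<partial>Q N)"
    by (simp add: integral_density)
  also have "\<dots> = (\<integral>w. ?S w * ln (?S w) \<partial>Q N)" using SF(2) by simp
  also have "\<dots> \<ge> (\<integral>w. ?S w - 1 \<partial>Q N)"
  proof (intro integral_mono)
    fix w
    have "- ln (?S w) \<le> 1 / ?S w - 1"
      using ln_le_minus_one[of "1 / ?S w"] symm_avg_pos[of g N w] by (simp add: ln_div)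
    then have "?S w * (1 - 1 / ?S w) \<le> ?S w * ln (?S w)"
      using symm_avg_pos[of g N w] by (intro mult_left_mono) auto
    then show "?S w - 1 \<le> ?S w * ln (?S w)"
      using symm_avg_pos[of g N w] by (simp add: right_diff_distrib)
  qed (use S SF in auto)
  moreover have "(\<integral>w. ?S w - 1 \<partial>Q N) = 0"
    using S prob_space one by simp
  ultimately show ?thesis by simp
qed

end

section \<open>Gibbs measures and their marginals\<close>

lemma symm_avg_add_const:
  "symm_avg (\<lambda>x. h x + c) N w = symm_avg h N w * exp (real N * c)"
  by (simp add: symm_avg_def sum.distrib exp_add sum_distrib_right)

text \<open>Each entry \<open>w j i\<close> has law \<open>\<mu> i\<close>, whatever the dependence
  within a row, so linearity evaluates the separable term. The functions \<open>f i\<close> may be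
  unbounded as long as they are integrable.\<close>

lemma expected_ln_symm_avg_add_separate:
  fixes h :: "('n::finite \<Rightarrow> real) \<Rightarrow> real" and \<mu> :: "'n \<Rightarrow> real measure"
  assumes h: "h \<in> borel_measurable (PiM UNIV (\<lambda>_. borel))" "\<And>x. \<bar>h x\<bar> \<le> B"
    and \<nu>: "prob_space \<nu>" "sets \<nu> = sets (PiM UNIV (\<lambda>_. borel))"
    and \<mu>: "\<And>i. distr \<nu> borel (\<lambda>x. x i) = \<mu> i"
    and f[measurable]: "\<And>i. f i \<in> borel_measurable borel" and int: "\<And>i. integrable (\<mu> i) (f i)"
  defines "g \<equiv> \<lambda>x. h x + (\<Sum>i\<in>UNIV. f i (x i))"
  shows "integrable (PiM {..<N} (\<lambda>_. \<nu>)) (\<lambda>w. ln (symm_avg g N w))"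
    and "(\<integral>w. ln (symm_avg g N w) \<partial>PiM {..<N} (\<lambda>_. \<nu>))
       = (\<integral>w. ln (symm_avg h N w) \<partial>PiM {..<N} (\<lambda>_. \<nu>)) + real N * (\<Sum>i\<in>UNIV. integral\<^sup>L (\<mu> i) (f i))"
proof -
  let ?P = "PiM {..<N} (\<lambda>_. \<nu>)"
  have eq: "ln (symm_avg g N w) = ln (symm_avg h N w) + (\<Sum>i\<in>UNIV. \<Sum>j<N. f i (w j i))" for w
    unfolding g_def symm_avg_add_separate using symm_avg_pos[of h N w] by (simp add: ln_mult_pos)
  have m: "(\<lambda>x. x i) \<in> borel_measurable \<nu>" for i
    by (simp add: measurable_cong_sets[OF \<nu>(2) refl])
  have "integrable ?P (\<lambda>w. f i (w j i)) \<and> (\<integral>w. f i (w j i) \<partial>?P) = integral\<^sup>L (\<mu> i) (f i)"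
    if j: "j < N" for i j
  proof -
    have c: "(\<lambda>w. w j) \<in> measurable ?P \<nu>"
      using j by (intro measurable_component_singleton[of j "{..<N}" "\<lambda>_. \<nu>"]) auto
    have "distr ?P borel (\<lambda>w. w j i) = distr (distr ?P \<nu> (\<lambda>w. w j)) borel (\<lambda>x. x i)"
      using c m by (subst distr_distr) (auto simp: o_def)
    also have "\<dots> = \<mu> i"
      using distr_PiM_component[of "{..<N}" "\<lambda>_. \<nu>" j] \<nu> \<mu>[of i] j by simp
    finally have d: "distr ?P borel (\<lambda>w. w j i) = \<mu> i" .
    have mc: "(\<lambda>w. w j i) \<in> borel_measurable ?P" using measurable_compose[OF c m] .
    show ?thesis
      using int[of i] integrable_distr_eq[OF mc f[of i]] integral_distr[OF mc f[of i]] by (simp add: d)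
  qed
  note * = this
  have S: "integrable ?P (\<lambda>w. ln (symm_avg h N w))"
    by (rule integrable_ln_symm_avg[OF h \<nu>])
  have F: "integrable ?P (\<lambda>w. \<Sum>i\<in>UNIV. \<Sum>j<N. f i (w j i))"
    using * by (intro Bochner_Integration.integrable_sum) auto
  show "integrable ?P (\<lambda>w. ln (symm_avg g N w))"
    unfolding eq using S F by auto
  have "(\<integral>w. (\<Sum>i\<in>UNIV. \<Sum>j<N. f i (w j i)) \<partial>?P) = (\<Sum>i\<in>UNIV. \<integral>w. (\<Sum>j<N. f i (w j i)) \<partial>?P)"
    using * by (intro Bochner_Integration.integral_sum Bochner_Integration.integrable_sum) auto
  also have "\<dots> = (\<Sum>i\<in>UNIV. real N * integral\<^sup>L (\<mu> i) (f i))"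
    using * by (intro sum.cong refl) (subst Bochner_Integration.integral_sum, auto)
  finally show "(\<integral>w. ln (symm_avg g N w) \<partial>?P)
       = (\<integral>w. ln (symm_avg h N w) \<partial>?P) + real N * (\<Sum>i\<in>UNIV. integral\<^sup>L (\<mu> i) (f i))"
    unfolding eq using S F by (simp add: sum_distrib_left)
qed

lemma sets_leb_UNIV: "sets (leb UNIV) = sets (PiM UNIV (\<lambda>_. borel))"
  unfolding leb_def by (intro sets_PiM_cong) auto

lemma sets_cube [measurable]: "finite I \<Longrightarrow> cube I R \<in> sets (leb I)"
  unfolding cube_def leb_def by (intro sets_PiM_I_finite) auto

lemma emeasure_cube:
  assumes "finite I" "0 < R"
  shows "emeasure (leb I) (cube I R) = ennreal ((2 * R) ^ card I)"
proof -
  interpret product_sigma_finite "\<lambda>_. lborel :: real measure" ..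
  have "emeasure (leb I) (cube I R) = (\<Prod>i\<in>I. emeasure lborel {-R..R})"
    unfolding leb_def cube_def using assms by (intro emeasure_PiM) auto
  also have "\<dots> = ennreal (2 * R) ^ card I" using assms by simp
  also have "\<dots> = ennreal ((2 * R) ^ card I)" using assms by (intro ennreal_power) simp
  finally show ?thesis .
qed

text \<open>Everything follows from squeezing \<open>exp (f x)\<close> between
  \<open>exp (- B)\<close> and \<open>exp B\<close>. Positivity ensures that the logarithms in
  \<open>pressure\<close> and \<open>partial_h\<close> are inverted by \<open>exp\<close>.\<close>

lemma cube_integral_bounds:
  fixes f :: "('i \<Rightarrow> real) \<Rightarrow> real"
  assumes I: "finite I" "0 < R" and [measurable]: "f \<in> borel_measurable (leb I)"
    and B: "\<And>x. \<bar>f x\<bar> \<le> B"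
  shows "set_integrable (leb I) (cube I R) (\<lambda>x. exp (f x))"
    and "(2 * R) ^ card I * exp (- B) \<le> (LINT x:cube I R|leb I. exp (f x))"
    and "(LINT x:cube I R|leb I. exp (f x)) \<le> (2 * R) ^ card I * exp B"
    and "0 < (LINT x:cube I R|leb I. exp (f x))"
    and "(\<integral>\<^sup>+x. ennreal (indicator (cube I R) x * exp (f x)) \<partial>leb I)
       = ennreal (LINT x:cube I R|leb I. exp (f x))"
proof -
  have b: "exp (- B) \<le> exp (f x)" "exp (f x) \<le> exp B" for x
    using B[of x] by (auto simp: abs_le_iff)
  note [measurable] = sets_cube[OF I(1)]
  have c: "integrable (leb I) (\<lambda>x. indicator (cube I R) x * c)" for c :: real
    using I by (intro integrable_mult_left integrable_real_indicator) (auto simp: emeasure_cube)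
  have ci: "(\<integral>x. indicator (cube I R) x * c \<partial>leb I) = (2 * R) ^ card I * c" for c :: real
    using I by (simp add: measure_def emeasure_cube)
  show int: "set_integrable (leb I) (cube I R) (\<lambda>x. exp (f x))"
    unfolding set_integrable_def using b
    by (intro Bochner_Integration.integrable_bound[OF c[of "exp B"]])
       (auto split: split_indicator)
  show 1: "(2 * R) ^ card I * exp (- B) \<le> (LINT x:cube I R|leb I. exp (f x))"
    unfolding ci[symmetric] set_lebesgue_integral_def using b int c
    by (intro integral_mono) (auto simp: set_integrable_def split: split_indicator)
  show "(LINT x:cube I R|leb I. exp (f x)) \<le> (2 * R) ^ card I * exp B"
    unfolding ci[symmetric] set_lebesgue_integral_def using b int c
    by (intro integral_mono) (auto simp: set_integrable_def split: split_indicator)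
  show "0 < (LINT x:cube I R|leb I. exp (f x))"
    using I by (intro less_le_trans[OF _ 1]) simp
  show "(\<integral>\<^sup>+x. ennreal (indicator (cube I R) x * exp (f x)) \<partial>leb I)
       = ennreal (LINT x:cube I R|leb I. exp (f x))"
    using int unfolding set_integrable_def set_lebesgue_integral_def
    by (subst nn_integral_eq_integral) auto
qed

text \<open>Continuity is absent on purpose: the equality case uses these results for
  \<open>h\<close> plus a multiple of an indicator.\<close>

locale bdd_potential =
  fixes R :: real and h :: "('n::finite \<Rightarrow> real) \<Rightarrow> real" and B :: real
  assumes R: "0 < R" and h_meas: "h \<in> borel_measurable (PiM UNIV (\<lambda>_. borel))"
    and h_bdd: "\<And>x. \<bar>h x\<bar> \<le> B"
begin

lemma h_meas_leb [measurable]: "h \<in> borel_measurable (leb UNIV)"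
  using h_meas by (simp add: measurable_cong_sets[OF sets_leb_UNIV refl])

lemmas cube_h = cube_integral_bounds[OF finite R h_meas_leb h_bdd]

lemma exp_pressure: "exp (pressure R h) = (LINT x:cube UNIV R|leb UNIV. exp (h x))"
  using cube_h(4) by (simp add: pressure_def)

lemma sets_gibbs: "sets (gibbs R h) = sets (PiM UNIV (\<lambda>_. borel))"
  by (simp add: gibbs_def sets_leb_UNIV)

lemma prob_space_gibbs: "prob_space (gibbs R h)"
proof
  note [measurable] = sets_cube[OF finite]
  have "emeasure (gibbs R h) (space (gibbs R h))
      = (\<integral>\<^sup>+x. ennreal (indicator (cube UNIV R) x * exp (h x - pressure R h)) \<partial>leb UNIV)"
    unfolding gibbs_def by (subst emeasure_density) (auto intro!: nn_integral_cong)
  also have "\<dots> = (\<integral>\<^sup>+x. ennreal (exp (- pressure R h)) * ennreal (indicator (cube UNIV R) x * exp (h x)) \<partial>leb UNIV)"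
    by (intro nn_integral_cong) (simp add: ennreal_mult[symmetric] exp_diff exp_minus field_simps)
  also have "\<dots> = ennreal (exp (- pressure R h)) * ennreal (exp (pressure R h))"
    by (subst nn_integral_cmult) (auto simp: cube_h(5) exp_pressure)
  also have "\<dots> = 1" by (simp add: ennreal_mult[symmetric] exp_minus)
  finally show "emeasure (gibbs R h) (space (gibbs R h)) = 1" .
qed

lemma slice_meas:
  "(\<lambda>(y, x). h (y(i := x))) \<in> borel_measurable (leb (UNIV - {i}) \<Otimes>\<^sub>M lborel)"
proof -
  have "(\<lambda>(f, y). f(i := y)) \<in> measurable (leb (UNIV - {i}) \<Otimes>\<^sub>M lborel) (leb UNIV)"
    using measurable_add_dim[of i "UNIV - {i}" "\<lambda>_. lborel :: real measure"]
    by (simp add: leb_def insert_absorb)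
  from measurable_compose[OF this h_meas_leb] show ?thesis by (simp add: case_prod_unfold)
qed

lemma slice_meas1: "(\<lambda>y. h (y(i := x))) \<in> borel_measurable (leb (UNIV - {i}))"
  using measurable_compose[OF measurable_Pair2'[of x lborel "leb (UNIV - {i})"] slice_meas] by simp

lemmas cube_slice = cube_integral_bounds[OF _ R slice_meas1 h_bdd, OF finite]

lemma exp_partial_h:
  "exp (partial_h R h i x) = (LINT y:cube (UNIV - {i}) R|leb (UNIV - {i}). exp (h (y(i := x))))"
  using cube_slice(4) by (simp add: partial_h_def)

lemma measurable_partial_h [measurable]: "partial_h R h i \<in> borel_measurable borel"
proof -
  interpret product_sigma_finite "\<lambda>_. lborel :: real measure" ..
  interpret sigma_finite_measure "leb (UNIV - {i})"
    unfolding leb_def by (rule sigma_finite) simp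
  note [measurable] = sets_cube[of "UNIV - {i}" R, simplified]
  have "(\<lambda>p. h ((snd p)(i := fst p))) \<in> borel_measurable (lborel \<Otimes>\<^sub>M leb (UNIV - {i}))"
    using measurable_compose[OF measurable_pair_swap' slice_meas[of i]] by (simp add: case_prod_unfold)
  then have "(\<lambda>x. LINT y:cube (UNIV - {i}) R|leb (UNIV - {i}). exp (h (y(i := x)))) \<in> borel_measurable lborel"
    unfolding set_lebesgue_integral_def
    by (intro borel_measurable_lebesgue_integral) (simp add: case_prod_unfold)
  then show ?thesis unfolding partial_h_def[abs_def] by simp
qed

lemma partial_h_bdd: "\<exists>C. \<forall>x. \<bar>partial_h R h i x\<bar> \<le> C"
proof -
  define c where "c = (2 * R) ^ card (UNIV - {i})"
  have c: "0 < c" using R by (simp add: c_def)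
  have "\<bar>partial_h R h i x\<bar> \<le> \<bar>ln c\<bar> + \<bar>B\<bar>" for x
  proof -
    have "ln (c * exp (- B)) \<le> partial_h R h i x" "partial_h R h i x \<le> ln (c * exp B)"
      unfolding partial_h_def c_def using cube_slice(2-4)[of i x] R by (subst ln_le_cancel_iff; simp)+
    then show ?thesis using c by (simp add: ln_mult_pos)
  qed
  then show ?thesis by blast
qed

text \<open>Tonelli's theorem integrates out every coordinate except \<open>i\<close>; the cube
  splits into the interval for \<open>x i\<close> and the cube of the remaining coordinates.\<close>

lemma marginal_density:
  "distr (gibbs R h) borel (\<lambda>x. x i)
     = density lborel (\<lambda>x. ennreal (indicator {-R..R} x * exp (partial_h R h i x - pressure R h)))"
    (is "_ = density lborel ?p")
proof (rule measure_eqI)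
  interpret product_sigma_finite "\<lambda>_. lborel :: real measure" ..
  note [measurable] = sets_cube[OF finite] sets_cube[of "UNIV - {i}" R, simplified]
  fix A assume "A \<in> sets (distr (gibbs R h) borel (\<lambda>x. x i))"
  then have A[measurable]: "A \<in> sets borel" by simp
  have mi[measurable]: "(\<lambda>x. x i) \<in> borel_measurable (leb UNIV)"
    by (simp add: measurable_cong_sets[OF sets_leb_UNIV refl])
  have mg: "(\<lambda>x. x i) \<in> borel_measurable (gibbs R h)"
    by (simp add: gibbs_def)
  define F where "F x = ennreal (indicator (cube UNIV R) x * exp (h x - pressure R h)) * indicator A (x i)" for x
  have [measurable]: "F \<in> borel_measurable (leb UNIV)"
    unfolding F_def by measurable
  have "emeasure (distr (gibbs R h) borel (\<lambda>x. x i)) A = emeasure (gibbs R h) ((\<lambda>x. x i) -` A \<inter> space (leb UNIV))"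
    using mg by (subst emeasure_distr) (auto simp: gibbs_def)
  also have "\<dots> = (\<integral>\<^sup>+x. F x \<partial>leb UNIV)"
    unfolding gibbs_def F_def
    by (subst emeasure_density) (auto intro!: nn_integral_cong split: split_indicator)
  also have "\<dots> = (\<integral>\<^sup>+x. (\<integral>\<^sup>+y. F (y(i := x)) \<partial>leb (UNIV - {i})) \<partial>lborel)"
    using product_nn_integral_insert_rev[of "UNIV - {i}" i F] by (simp add: leb_def[symmetric] insert_absorb)
  also have "\<dots> = (\<integral>\<^sup>+x. ?p x * indicator A x \<partial>lborel)"
  proof (intro nn_integral_cong)
    fix x :: real
    have "F (y(i := x)) = ennreal (indicator {-R..R} x * exp (- pressure R h)) * indicator A x
        * ennreal (indicator (cube (UNIV - {i}) R) y * exp (h (y(i := x))))"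
      if y: "y \<in> space (leb (UNIV - {i}))" for y
    proof -
      have "y(i := x) \<in> cube UNIV R \<longleftrightarrow> x \<in> {-R..R} \<and> y \<in> cube (UNIV - {i}) R"
        using y by (auto simp: cube_def leb_def space_PiM PiE_iff)
      then have "indicator (cube UNIV R) (y(i := x)) = (indicator {-R..R} x * indicator (cube (UNIV - {i}) R) y :: real)"
        by (auto simp: indicator_def)
      then show ?thesis
        by (auto simp: F_def ennreal_mult[symmetric] exp_diff exp_minus field_simps split: split_indicator)
    qed
    then have "(\<integral>\<^sup>+y. F (y(i := x)) \<partial>leb (UNIV - {i})) = ennreal (indicator {-R..R} x * exp (- pressure R h)) * indicator A x
        * (\<integral>\<^sup>+y. ennreal (indicator (cube (UNIV - {i}) R) y * exp (h (y(i := x)))) \<partial>leb (UNIV - {i}))"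
      using slice_meas1[of i x] by (subst nn_integral_cmult[symmetric]) (auto intro!: nn_integral_cong)
    also have "\<dots> = ?p x * indicator A x"
      unfolding cube_slice(5) exp_partial_h[symmetric]
      by (auto simp: ennreal_mult[symmetric] exp_diff exp_minus field_simps split: split_indicator)
    finally show "(\<integral>\<^sup>+y. F (y(i := x)) \<partial>leb (UNIV - {i})) = ?p x * indicator A x" .
  qed
  also have "\<dots> = emeasure (density lborel ?p) A"
    by (subst emeasure_density) auto
  finally show "emeasure (distr (gibbs R h) borel (\<lambda>x. x i)) A = emeasure (density lborel ?p) A" .
qed simp

text \<open>The normalization is read off from the marginal having total mass one, which avoids a
  second use of Fubini.\<close>

lemma pressure1_partial_h: "pressure1 R (partial_h R h i) = pressure R h"
proof -
  have "prob_space (density lborel (\<lambda>x. ennreal (indicator {-R..R} x * exp (partial_h R h i x - pressure R h))))"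
    unfolding marginal_density[symmetric]
    by (intro prob_space.prob_space_distr prob_space_gibbs)
       (simp add: measurable_cong_sets[OF sets_gibbs refl])
  from prob_space.emeasure_space_1[OF this]
  have "1 = (\<integral>\<^sup>+x. ennreal (indicator {-R..R} x * exp (partial_h R h i x - pressure R h)) \<partial>lborel)"
    by (subst (asm) emeasure_density) auto
  also have "\<dots> = (\<integral>\<^sup>+x. ennreal (exp (- pressure R h)) * ennreal (indicator {-R..R} x * exp (partial_h R h i x)) \<partial>lborel)"
    by (intro nn_integral_cong) (simp add: ennreal_mult[symmetric] exp_diff exp_minus field_simps)
  also have "\<dots> = ennreal (exp (- pressure R h)) * (\<integral>\<^sup>+x. ennreal (indicator {-R..R} x * exp (partial_h R h i x)) \<partial>lborel)"
    by (subst nn_integral_cmult) auto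
  finally have "ennreal (exp (pressure R h)) * 1 = ennreal (exp (pressure R h)) * (ennreal (exp (- pressure R h)) *
      (\<integral>\<^sup>+x. ennreal (indicator {-R..R} x * exp (partial_h R h i x)) \<partial>lborel))" by simp
  then have "(\<integral>\<^sup>+x. ennreal (indicator {-R..R} x * exp (partial_h R h i x)) \<partial>lborel) = ennreal (exp (pressure R h))"
    by (simp add: mult.assoc[symmetric] ennreal_mult[symmetric] exp_minus)
  then have "(LINT x:{-R..R}|lborel. exp (partial_h R h i x)) = exp (pressure R h)"
    unfolding set_lebesgue_integral_def by (subst integral_eq_nn_integral) auto
  then show ?thesis by (simp add: pressure1_def)
qed

text \<open>This identity is the whole equivalence of (ii) and (iii).\<close>

lemma marginal_gibbs1: "distr (gibbs R h) borel (\<lambda>x. x i) = gibbs1 R (partial_h R h i)"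
  by (simp add: marginal_density gibbs1_def pressure1_partial_h)

end

section \<open>Entropy and the two bounds on the pressure\<close>

lemma plogp_eq: "plogp t = t * ln t"
  by (simp add: plogp_def)

text \<open>A bound for the negative part of p ln p. On a bounded interval its integral is then
  finite, so the difference of integrals in \<open>entropy_BG\<close> is never of the form infinity
  minus infinity.\<close>

lemma minus_plogp_le_1: "0 \<le> t \<Longrightarrow> - plogp t \<le> 1"
proof (cases "t = 0")
  case False
  assume "0 \<le> t"
  with False have "- ln t \<le> 1 / t - 1" using ln_le_minus_one[of "1/t"] by (simp add: ln_div)
  then have "t * (- ln t) \<le> t * (1 / t - 1)" using \<open>0 \<le> t\<close> by (rule mult_left_mono)
  also have "\<dots> = 1 - t" using False by (simp add: right_diff_distrib)
  finally show ?thesis using \<open>0 \<le> t\<close> by (simp add: plogp_eq)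
qed (simp add: plogp_def)

lemma prob_on_density_AE_0:
  assumes \<mu>: "prob_on R \<mu>" "\<mu> = density lborel q" and [measurable]: "q \<in> borel_measurable borel"
  shows "AE x in lborel. x \<notin> {-R..R} \<longrightarrow> q x = 0"
proof -
  have "AE x in density lborel q. x \<in> {-R..R}" using prob_on_AE[OF \<mu>(1)] unfolding \<mu>(2) .
  then have "AE x in lborel. 0 < q x \<longrightarrow> x \<in> {-R..R}" by (subst (asm) AE_density) auto
  then show ?thesis by eventually_elim (auto simp: zero_less_iff_neq_zero)
qed

text \<open>Densities are unique almost everywhere, so the choice inside \<open>entropy_BG\<close>
  is harmless. The negative part of p ln p has finite integral, hence the entropy is finite exactly
  when \<open>ln (p x)\<close> is integrable under \<open>\<mu>\<close>. The convention
  \<open>ln 0 = 0\<close> affects only a \<open>\<mu>\<close>-null set.\<close>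

lemma entropy_BG_density:
  assumes \<mu>: "prob_on R \<mu>" "\<mu> = density lborel (\<lambda>x. ennreal (p x))"
    and p[measurable]: "p \<in> borel_measurable borel" and nn: "\<And>x. 0 \<le> p x"
  shows "entropy_BG \<mu> = (if integrable \<mu> (\<lambda>x. ln (p x)) then ereal (- integral\<^sup>L \<mu> (\<lambda>x. ln (p x))) else -\<infinity>)"
proof -
  define q where "q = (SOME p. p \<in> borel_measurable borel \<and> \<mu> = density lborel p)"
  have ex: "\<exists>p. p \<in> borel_measurable borel \<and> \<mu> = density lborel p"
    using \<mu>(2) p by (intro exI[of _ "\<lambda>x. ennreal (p x)"]) auto
  have q: "q \<in> borel_measurable borel" "\<mu> = density lborel q"
    unfolding q_def using someI_ex[OF ex] by auto
  have "AE x in lborel. q x = ennreal (p x)"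
    using q \<mu>(2) by (intro sigma_finite_measure.density_unique[OF sigma_finite_lborel]) auto
  then have qp: "AE x in lborel. enn2real (q x) = p x"
    by eventually_elim (simp add: nn)
  let ?f = "\<lambda>x. p x * ln (p x)"
  have "(\<integral>\<^sup>+x. ennreal (- ?f x) \<partial>lborel) \<le> (\<integral>\<^sup>+x. indicator {-R..R} x \<partial>lborel)"
  proof (rule nn_integral_mono_AE)
    have "AE x in lborel. x \<notin> {-R..R} \<longrightarrow> ennreal (p x) = 0"
      by (rule prob_on_density_AE_0[OF \<mu>]) simp
    then show "AE x in lborel. ennreal (- ?f x) \<le> indicator {-R..R} x"
    proof eventually_elim
      case (elim x)
      then show ?case
        using minus_plogp_le_1[OF nn[of x]] nn[of x]
        by (cases "x \<in> {-R..R}") (auto simp: plogp_eq)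
    qed
  qed
  also have "\<dots> < \<infinity>" by (cases "-R \<le> R") auto
  finally have neg: "(\<integral>\<^sup>+x. ennreal (- ?f x) \<partial>lborel) < \<infinity>" .
  have int: "integrable lborel ?f \<longleftrightarrow> (\<integral>\<^sup>+x. ennreal (?f x) \<partial>lborel) \<noteq> \<infinity>"
    using neg by (auto simp: real_integrable_def)
  have int\<mu>: "integrable \<mu> (\<lambda>x. ln (p x)) \<longleftrightarrow> integrable lborel ?f"
    unfolding \<mu>(2) by (subst integrable_density) (auto simp: nn)
  have intg\<mu>: "integral\<^sup>L \<mu> (\<lambda>x. ln (p x)) = integral\<^sup>L lborel ?f"
    unfolding \<mu>(2) by (subst integral_density) (auto simp: nn)
  have "has_density \<mu>" using ex by (simp add: has_density_def)
  then have "entropy_BG \<mu> = enn2ereal (\<integral>\<^sup>+ x. ennreal (- plogp (enn2real (q x))) \<partial>lborel)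
           - enn2ereal (\<integral>\<^sup>+ x. ennreal (plogp (enn2real (q x))) \<partial>lborel)"
    by (simp add: entropy_BG_def q_def Let_def)
  also have "(\<integral>\<^sup>+ x. ennreal (- plogp (enn2real (q x))) \<partial>lborel) = (\<integral>\<^sup>+x. ennreal (- ?f x) \<partial>lborel)"
    using qp by (intro nn_integral_cong_AE) (auto elim!: eventually_mono simp: plogp_eq)
  also have "(\<integral>\<^sup>+ x. ennreal (plogp (enn2real (q x))) \<partial>lborel) = (\<integral>\<^sup>+x. ennreal (?f x) \<partial>lborel)"
    using qp by (intro nn_integral_cong_AE) (auto elim!: eventually_mono simp: plogp_eq)
  finally have H: "entropy_BG \<mu> = enn2ereal (\<integral>\<^sup>+x. ennreal (- ?f x) \<partial>lborel) - enn2ereal (\<integral>\<^sup>+x. ennreal (?f x) \<partial>lborel)" .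
  obtain a where a: "0 \<le> a" "(\<integral>\<^sup>+x. ennreal (- ?f x) \<partial>lborel) = ennreal a"
    using neg by (cases "\<integral>\<^sup>+x. ennreal (- ?f x) \<partial>lborel") auto
  show ?thesis
  proof (cases "\<integral>\<^sup>+x. ennreal (?f x) \<partial>lborel")
    case (real b)
    then have "integrable lborel ?f" using int by simp
    moreover from this have "integral\<^sup>L lborel ?f = b - a"
      using real a by (subst real_lebesgue_integral_def) auto
    ultimately show ?thesis
      using H real a by (simp add: int\<mu> intg\<mu>)
  next
    case top
    then show ?thesis using H int a by (simp add: int\<mu>)
  qed
qed

text \<open>The density is changed on a null set so that it is real-valued and vanishes everywhere
  off the interval; the pointwise estimate in \<open>expected_ln_symm_avg_le_pressure\<close> relies
  on this.\<close>

lemma entropy_BG_cases: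
  assumes \<mu>: "prob_on R \<mu>"
  obtains "entropy_BG \<mu> = -\<infinity>"
  | p where "p \<in> borel_measurable borel" "\<And>x. 0 \<le> p x" "\<And>x. x \<notin> {-R..R} \<Longrightarrow> p x = 0"
      "\<mu> = density lborel (\<lambda>x. ennreal (p x))" "integrable \<mu> (\<lambda>x. ln (p x))"
      "entropy_BG \<mu> = ereal (- integral\<^sup>L \<mu> (\<lambda>x. ln (p x)))"
proof (cases "has_density \<mu>")
  case False
  then have "entropy_BG \<mu> = -\<infinity>" by (simp add: entropy_BG_def)
  then show ?thesis by (rule that(1))
next
  case True
  then obtain q where q[measurable]: "q \<in> borel_measurable borel" and \<mu>q: "\<mu> = density lborel q"
    by (auto simp: has_density_def)
  interpret prob_space \<mu> using \<mu> by (simp add: prob_on_def)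
  define p where "p x = enn2real (q x) * indicator {-R..R} x" for x
  have p: "p \<in> borel_measurable borel" "\<And>x. 0 \<le> p x" "\<And>x. x \<notin> {-R..R} \<Longrightarrow> p x = 0"
    unfolding p_def by auto
  have "(\<integral>\<^sup>+x. q x \<partial>lborel) = emeasure \<mu> (space \<mu>)"
    unfolding \<mu>q by (subst emeasure_density) (auto intro!: nn_integral_cong)
  then have "AE x in lborel. q x \<noteq> \<infinity>"
    by (intro nn_integral_noteq_infinite) (auto simp: emeasure_space_1)
  with prob_on_density_AE_0[OF \<mu> \<mu>q q] have "AE x in lborel. q x = ennreal (p x)"
    by eventually_elim (auto simp: p_def less_top[symmetric] split: split_indicator)
  then have d: "\<mu> = density lborel (\<lambda>x. ennreal (p x))"
    unfolding \<mu>q using p(1) by (intro density_cong) auto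
  show ?thesis
    using that p d entropy_BG_density[OF \<mu> d p(1,2)]
    by (cases "integrable \<mu> (\<lambda>x. ln (p x))") auto
qed

context bdd_potential
begin

text \<open>With g = h minus the sum of the \<open>ln (p i (x i))\<close>, the measure e^g \<pi> is
  at most e^h times Lebesgue measure on the cube, so the tangent bound applies with Z = e^P(h). The
  subtracted logarithms reappear as their expectations.\<close>

lemma expected_ln_symm_avg_le_pressure:
  assumes \<mu>: "\<And>i. prob_on R (\<mu> i)"
    and p[measurable]: "\<And>i. p i \<in> borel_measurable borel" and nn: "\<And>i x. 0 \<le> p i x"
    and supp: "\<And>i x. x \<notin> {-R..R} \<Longrightarrow> p i x = 0"
    and d: "\<And>i. \<mu> i = density lborel (\<lambda>x. ennreal (p i x))"
    and int: "\<And>i. integrable (\<mu> i) (\<lambda>x. ln (p i x))" and N: "0 < N"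
  shows "(\<integral>w. ln (symm_avg h N w) \<partial>PiM {..<N} (\<lambda>_. PiM UNIV \<mu>)) / real N
     \<le> pressure R h + (\<Sum>i\<in>UNIV. integral\<^sup>L (\<mu> i) (\<lambda>x. ln (p i x)))"
proof -
  interpret product_marginals \<mu>
    using \<mu> by (simp add: product_marginals_def prob_on_def)
  let ?\<pi> = "PiM UNIV \<mu>"
  define g where "g x = h x + (\<Sum>i\<in>UNIV. - ln (p i (x i)))" for x
  note [measurable] = h_meas
  have g: "g \<in> borel_measurable (PiM UNIV (\<lambda>_. borel))" unfolding g_def by measurable
  have marg: "distr ?\<pi> borel (\<lambda>x. x i) = \<mu> i" for i
    using distr_PiM_component[of UNIV \<mu> i] prob sets_\<mu> distr_cong[of ?\<pi> ?\<pi> borel "\<mu> i" "\<lambda>x. x i" "\<lambda>x. x i"] by simp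
  have sep: "integrable (Q N) (\<lambda>w. ln (symm_avg g N w))"
    "(\<integral>w. ln (symm_avg g N w) \<partial>Q N) = (\<integral>w. ln (symm_avg h N w) \<partial>Q N)
       + real N * (\<Sum>i\<in>UNIV. integral\<^sup>L (\<mu> i) (\<lambda>x. - ln (p i x)))"
    unfolding g_def Q_def using int
    by (intro expected_ln_symm_avg_add_separate[OF h_meas h_bdd prob_space_prod sets_prod marg]; simp)+
  have \<pi>: "?\<pi> = density (leb UNIV) (\<lambda>x. \<Prod>i\<in>UNIV. ennreal (p i (x i)))"
    unfolding leb_def d
    by (rule PiM_density) (auto simp: d[symmetric] prob prob_space_imp_sigma_finite lborel.sigma_finite_measure_axioms)
  have g'[measurable]: "g \<in> borel_measurable (leb UNIV)" "g \<in> borel_measurable ?\<pi>"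
    using g by (simp_all add: measurable_cong_sets[OF sets_leb_UNIV refl] measurable_cong_sets[OF sets_prod refl])
  have pm: "(\<lambda>x. \<Prod>i\<in>UNIV. ennreal (p i (x i))) \<in> borel_measurable (leb UNIV)"
    unfolding measurable_cong_sets[OF sets_leb_UNIV refl] by measurable
  \<comment> \<open>Where all densities are positive, they cancel against \<open>exp (g x)\<close>.
    Where one vanishes, the left side is 0 whatever value \<open>ln 0\<close> has; this is why only
    an inequality holds.\<close>
  have pw: "(\<Prod>i\<in>UNIV. ennreal (p i (x i))) * ennreal (exp (g x)) \<le> ennreal (indicator (cube UNIV R) x * exp (h x))"
    for x :: "'n \<Rightarrow> real"
  proof (cases "\<forall>i. 0 < p i (x i)")
    case True
    then have "x i \<in> {-R..R}" for i using supp[of "x i" i] by (metis less_irrefl)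
    then have x: "x \<in> cube UNIV R" by (auto simp: cube_def PiE_iff)
    have "(\<Prod>i\<in>UNIV. ennreal (p i (x i))) * ennreal (exp (g x)) = ennreal ((\<Prod>i\<in>UNIV. p i (x i)) * exp (g x))"
      by (simp add: prod_ennreal nn ennreal_mult prod_nonneg)
    also have "(\<Prod>i\<in>UNIV. p i (x i)) * exp (g x) = exp (h x)"
      using True by (simp add: g_def exp_add exp_sum exp_minus less_imp_neq[symmetric] flip: prod.distrib)
    finally show ?thesis using x by simp
  next
    case False
    then obtain i where "p i (x i) = 0" using nn by (metis less_eq_real_def)
    then have "(\<Prod>i\<in>UNIV. ennreal (p i (x i))) = 0" by (intro prod_zero) (auto intro!: exI[of _ i])
    then show ?thesis by (simp only: mult_zero_left zero_le)
  qed
  have "(\<integral>\<^sup>+x. ennreal (exp (g x)) \<partial>?\<pi>) = (\<integral>\<^sup>+x. (\<Prod>i\<in>UNIV. ennreal (p i (x i))) * ennreal (exp (g x)) \<partial>leb UNIV)"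
    unfolding \<pi> using pm by (subst nn_integral_density) auto
  also have "\<dots> \<le> ennreal (exp (pressure R h))"
    unfolding exp_pressure cube_h(5)[symmetric] by (intro nn_integral_mono pw)
  finally have le: "(\<integral>\<^sup>+x. ennreal (exp (g x)) \<partial>?\<pi>) \<le> ennreal (exp (pressure R h))" .
  then have ie: "integrable ?\<pi> (\<lambda>x. exp (g x))"
    by (intro integrableI_bounded) (auto intro: le_less_trans simp: less_top[symmetric] top_unique)
  have "(\<integral>x. exp (g x) \<partial>?\<pi>) \<le> exp (pressure R h)"
    using le nn_integral_eq_integral[OF ie] by (simp add: ennreal_le_iff)
  from expected_ln_symm_avg_le[OF g N ie this _ sep(1)]
  have "(\<integral>w. ln (symm_avg h N w) \<partial>Q N) \<le> real N * (pressure R h + (\<Sum>i\<in>UNIV. integral\<^sup>L (\<mu> i) (\<lambda>x. ln (p i x))))"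
    by (simp add: sep(2) sum_negf algebra_simps)
  then show ?thesis using N by (simp add: Q_def divide_le_eq mult.commute)
qed

text \<open>Here \<open>l i\<close> is the logarithm of the density of the i-th Gibbs marginal on
  the interval. It is bounded, so the Gibbs measure is a tilt of the product of its marginals by a
  bounded exponent.\<close>

lemma expected_ln_symm_avg_gibbs_ge:
  assumes \<mu>: "\<And>i. \<mu> i = distr (gibbs R h) borel (\<lambda>x. x i)" and N: "0 < N"
  defines "l \<equiv> \<lambda>i x. partial_h R h i x - pressure R h"
  shows "pressure R h + (\<Sum>i\<in>UNIV. integral\<^sup>L (\<mu> i) (l i))
     \<le> (\<integral>w. ln (symm_avg h N w) \<partial>PiM {..<N} (\<lambda>_. gibbs R h)) / real N"
proof -
  interpret G: prob_space "gibbs R h" by (rule prob_space_gibbs)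
  have prob\<mu>: "prob_space (\<mu> i)" for i
    unfolding \<mu> by (intro G.prob_space_distr) (simp add: measurable_cong_sets[OF sets_gibbs refl])
  interpret product_marginals \<mu>
    using prob\<mu> by (simp add: product_marginals_def \<mu>)
  let ?\<pi> = "PiM UNIV \<mu>"
  obtain C where C: "\<And>i x. \<bar>partial_h R h i x\<bar> \<le> C i" using partial_h_bdd by metis
  define D where "D i = C i + \<bar>pressure R h\<bar>" for i
  have lD: "\<bar>l i x\<bar> \<le> D i" for i x using C[of i x] by (simp add: l_def D_def)
  have l[measurable]: "l i \<in> borel_measurable borel" for i unfolding l_def by measurable
  have d: "\<mu> i = density lborel (\<lambda>x. ennreal (indicator {-R..R} x * exp (l i x)))" for i
    unfolding \<mu> marginal_density l_def ..
  \<comment> \<open>The logarithm of the density of the Gibbs measure with respect to the product of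
    its marginals. The bracketing lets the separable part and the constant be split off in
    turn.\<close>
  define g where "g x = (h x + (- pressure R h)) + (\<Sum>i\<in>UNIV. - l i (x i))" for x
  note [measurable] = h_meas
  have g: "g \<in> borel_measurable (PiM UNIV (\<lambda>_. borel))" unfolding g_def by measurable
  have gB: "\<bar>g x\<bar> \<le> B + \<bar>pressure R h\<bar> + (\<Sum>i\<in>UNIV. D i)" for x
  proof -
    have "\<bar>\<Sum>i\<in>UNIV. - l i (x i)\<bar> \<le> (\<Sum>i\<in>UNIV. D i)"
      by (rule order_trans[OF sum_abs]) (auto intro!: sum_mono lD)
    then show ?thesis using h_bdd[of x] unfolding g_def by linarith
  qed
  have \<pi>: "?\<pi> = density (leb UNIV) (\<lambda>x. \<Prod>i\<in>UNIV. ennreal (indicator {-R..R} (x i) * exp (l i (x i))))"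
    unfolding leb_def d
    by (rule PiM_density) (auto simp: d[symmetric] prob prob_space_imp_sigma_finite lborel.sigma_finite_measure_axioms)
  have pm: "(\<lambda>x. \<Prod>i\<in>UNIV. ennreal (indicator {-R..R} (x i) * exp (l i (x i)))) \<in> borel_measurable (leb UNIV)"
    unfolding measurable_cong_sets[OF sets_leb_UNIV refl] by measurable
  have g'[measurable]: "g \<in> borel_measurable (leb UNIV)" "g \<in> borel_measurable ?\<pi>"
    using g by (simp_all add: measurable_cong_sets[OF sets_leb_UNIV refl] measurable_cong_sets[OF sets_prod refl])
  have pw: "(\<Prod>i\<in>UNIV. ennreal (indicator {-R..R} (x i) * exp (l i (x i)))) * ennreal (exp (g x))
      = ennreal (indicator (cube UNIV R) x * exp (h x - pressure R h))" for x :: "'n \<Rightarrow> real"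
  proof -
    have ind: "(\<Prod>i\<in>UNIV. indicator {-R..R} (x i)) = (indicator (cube UNIV R) x :: real)"
    proof (cases "x \<in> cube UNIV R")
      case True
      then show ?thesis by (intro trans[OF prod.neutral]) (auto simp: cube_def PiE_iff)
    next
      case False
      then obtain i where "x i \<notin> {-R..R}" by (auto simp: cube_def PiE_iff)
      then show ?thesis using False by (subst prod_zero) (auto intro!: exI[of _ i])
    qed
    have "(\<Prod>i\<in>UNIV. ennreal (indicator {-R..R} (x i) * exp (l i (x i)))) * ennreal (exp (g x))
        = ennreal ((\<Prod>i\<in>UNIV. indicator {-R..R} (x i) * exp (l i (x i))) * exp (g x))"
      by (subst prod_ennreal) (auto simp: ennreal_mult[symmetric] prod_nonneg)
    also have "(\<Prod>i\<in>UNIV. indicator {-R..R} (x i) * exp (l i (x i))) * exp (g x)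
        = indicator (cube UNIV R) x * exp ((\<Sum>i\<in>UNIV. l i (x i)) + g x)"
      by (simp add: prod.distrib ind exp_add exp_sum)
    also have "(\<Sum>i\<in>UNIV. l i (x i)) + g x = h x - pressure R h" by (simp add: g_def sum_negf)
    finally show ?thesis .
  qed
  have tilt: "density ?\<pi> (\<lambda>x. ennreal (exp (g x))) = gibbs R h"
    unfolding \<pi> gibbs_def using pm by (subst density_density_eq) (auto simp: pw)
  have "(\<integral>\<^sup>+x. ennreal (exp (g x)) \<partial>?\<pi>) = emeasure (density ?\<pi> (\<lambda>x. ennreal (exp (g x)))) (space ?\<pi>)"
    by (subst emeasure_density) (auto intro!: nn_integral_cong)
  also have "\<dots> = 1" using G.emeasure_space_1 unfolding tilt[symmetric] by simp
  finally have one: "(\<integral>x. exp (g x) \<partial>?\<pi>) = 1"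
    by (subst integral_eq_nn_integral) auto
  have "integrable (\<mu> i) (l i)" for i
  proof -
    interpret prob_space "\<mu> i" by (rule prob)
    show ?thesis using lD by (intro integrable_const_bound[where B="D i"]) (auto simp: measurable_cong_sets[OF sets_\<mu> refl])
  qed
  then have sep: "(\<integral>w. ln (symm_avg g N w) \<partial>PiM {..<N} (\<lambda>_. gibbs R h))
     = (\<integral>w. ln (symm_avg (\<lambda>x. h x + (- pressure R h)) N w) \<partial>PiM {..<N} (\<lambda>_. gibbs R h))
       + real N * (\<Sum>i\<in>UNIV. integral\<^sup>L (\<mu> i) (\<lambda>x. - l i x))"
    unfolding g_def
  proof (intro expected_ln_symm_avg_add_separate(2)[where B="B + \<bar>pressure R h\<bar>", OF _ _ prob_space_gibbs sets_gibbs \<mu>[symmetric]])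
    show "\<bar>h x + - pressure R h\<bar> \<le> B + \<bar>pressure R h\<bar>" for x using h_bdd[of x] by linarith
  qed auto
  interpret P: prob_space "PiM {..<N} (\<lambda>_. gibbs R h)" by (intro prob_space_PiM prob_space_gibbs)
  have "ln (symm_avg (\<lambda>x. h x + (- pressure R h)) N w) = ln (symm_avg h N w) - real N * pressure R h" for w
    unfolding symm_avg_add_const using symm_avg_pos[of h N w] by (simp add: ln_mult_pos)
  then have "(\<integral>w. ln (symm_avg (\<lambda>x. h x + (- pressure R h)) N w) \<partial>PiM {..<N} (\<lambda>_. gibbs R h))
     = (\<integral>w. ln (symm_avg h N w) \<partial>PiM {..<N} (\<lambda>_. gibbs R h)) - real N * pressure R h"
    using integrable_ln_symm_avg[OF h_meas h_bdd prob_space_gibbs sets_gibbs] P.prob_space by simp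
  moreover have "0 \<le> (\<integral>w. ln (symm_avg g N w) \<partial>PiM {..<N} (\<lambda>_. gibbs R h))"
    using expected_ln_symm_avg_tilted_ge[OF g N gB one] by (simp only: tilt)
  ultimately have "real N * (pressure R h + (\<Sum>i\<in>UNIV. integral\<^sup>L (\<mu> i) (l i)))
     \<le> (\<integral>w. ln (symm_avg h N w) \<partial>PiM {..<N} (\<lambda>_. gibbs R h))"
    unfolding sep by (simp add: sum_negf algebra_simps)
  then show ?thesis using N by (simp add: le_divide_eq mult.commute)
qed

text \<open>The ratio of the two partition functions is the Gibbs expectation of exp (t 1_A), and
  this function equals 1 + (e^t - 1) 1_A.\<close>

lemma pressure_add_indicator:
  assumes [measurable]: "A \<in> sets borel"
  shows "pressure R (\<lambda>x. h x + t * indicator A (x i))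
       = pressure R h + ln (1 + (exp t - 1) * measure (distr (gibbs R h) borel (\<lambda>x. x i)) A)"
proof -
  interpret G: prob_space "gibbs R h" by (rule prob_space_gibbs)
  note [measurable] = sets_cube[OF finite]
  have mi[measurable]: "(\<lambda>x. x i) \<in> borel_measurable (leb UNIV)"
    by (simp add: measurable_cong_sets[OF sets_leb_UNIV refl])
  have mg[measurable]: "(\<lambda>x. x i) \<in> borel_measurable (gibbs R h)"
    by (simp add: gibbs_def)
  let ?q = "measure (distr (gibbs R h) borel (\<lambda>x. x i)) A"
  have "?q = (\<integral>y. indicator A y \<partial>distr (gibbs R h) borel (\<lambda>x. x i))" by simp
  also have "\<dots> = (\<integral>x. indicator A (x i) \<partial>gibbs R h)" by (rule integral_distr) auto
  finally have q: "?q = (\<integral>x. indicator A (x i) \<partial>gibbs R h)" .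
  have "1 + (exp t - 1) * ?q = (\<integral>x. 1 + (exp t - 1) * indicator A (x i) \<partial>gibbs R h)"
    unfolding q using G.prob_space
    by (subst Bochner_Integration.integral_add)
       (auto intro!: integrable_mult_right G.integrable_const_bound[where B=1] split: split_indicator)
  also have "\<dots> = (\<integral>x. exp (t * indicator A (x i)) \<partial>gibbs R h)"
    by (intro Bochner_Integration.integral_cong) (auto split: split_indicator)
  also have "\<dots> = (\<integral>x. indicator (cube UNIV R) x * exp (h x - pressure R h) * exp (t * indicator A (x i)) \<partial>leb UNIV)"
    unfolding gibbs_def by (subst integral_density) auto
  also have "\<dots> = (\<integral>x. exp (- pressure R h) * (indicator (cube UNIV R) x * exp (h x + t * indicator A (x i))) \<partial>leb UNIV)"
    by (intro Bochner_Integration.integral_cong) (auto simp: exp_diff exp_minus exp_add field_simps)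
  also have "\<dots> = exp (- pressure R h) * (LINT x:cube UNIV R|leb UNIV. exp (h x + t * indicator A (x i)))"
    by (simp add: set_lebesgue_integral_def)
  finally have eq: "1 + (exp t - 1) * ?q = exp (- pressure R h) * (LINT x:cube UNIV R|leb UNIV. exp (h x + t * indicator A (x i)))" .
  have "0 < (LINT x:cube UNIV R|leb UNIV. exp (h x + t * indicator A (x i)))"
  proof (rule cube_integral_bounds(4)[where B="B + \<bar>t\<bar>"])
    show "\<bar>h x + t * indicator A (x i)\<bar> \<le> B + \<bar>t\<bar>" for x
      using h_bdd[of x] by (auto split: split_indicator)
  qed (use R in auto)
  then show ?thesis unfolding eq by (simp add: pressure_def[of R "\<lambda>x. h x + t * indicator A (x i)"] ln_mult_pos)
qed

end

section \<open>The equality case\<close>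

text \<open>Neither sequence need converge, but \<open>c - (a N - b N)\<close> does, and it
  dominates \<open>b N\<close>.\<close>

lemma limsup_le_of_diff_tendsto_0:
  fixes a b :: "nat \<Rightarrow> real"
  assumes "(\<lambda>N. a N - b N) \<longlonglongrightarrow> 0" "\<And>N. 0 < N \<Longrightarrow> a N \<le> c"
  shows "limsup (\<lambda>N. ereal (b N)) \<le> ereal c"
proof -
  have "(\<lambda>N. ereal (c - (a N - b N))) \<longlonglongrightarrow> ereal (c - 0)"
    using assms(1) by (intro tendsto_intros)
  then have "limsup (\<lambda>N. ereal (c - (a N - b N))) = ereal c"
    by (intro lim_imp_Limsup) auto
  moreover have "limsup (\<lambda>N. ereal (b N)) \<le> limsup (\<lambda>N. ereal (c - (a N - b N)))"
    using assms(2) by (intro Limsup_mono eventually_mono[OF eventually_gt_at_top[of 0]]) auto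
  ultimately show ?thesis by simp
qed

lemma limsup_ge_of_diff_tendsto_0:
  fixes a b :: "nat \<Rightarrow> real"
  assumes "(\<lambda>N. a N - b N) \<longlonglongrightarrow> 0" "\<And>N. 0 < N \<Longrightarrow> c \<le> a N"
  shows "ereal c \<le> limsup (\<lambda>N. ereal (b N))"
proof -
  have "(\<lambda>N. ereal (c - (a N - b N))) \<longlonglongrightarrow> ereal (c - 0)"
    using assms(1) by (intro tendsto_intros)
  then have "limsup (\<lambda>N. ereal (c - (a N - b N))) = ereal c"
    by (intro lim_imp_Limsup) auto
  moreover have "limsup (\<lambda>N. ereal (c - (a N - b N))) \<le> limsup (\<lambda>N. ereal (b N))"
    using assms(2) by (intro Limsup_mono eventually_mono[OF eventually_gt_at_top[of 0]]) auto
  ultimately show ?thesis by simp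
qed

text \<open>A comparison of slopes at 0, done without derivatives: \<open>ln (1 + s) \<le> s\<close>
  and \<open>exp t \<le> 1 + t + t * t\<close> give \<open>m \<le> (1 + t) * q\<close>.\<close>

lemma le_of_linear_le_ln:
  fixes m q :: real
  assumes "0 \<le> q" and le: "\<And>t. 0 < t \<Longrightarrow> t \<le> 1 \<Longrightarrow> t * m \<le> ln (1 + (exp t - 1) * q)"
  shows "m \<le> q"
proof (rule ccontr)
  assume "\<not> m \<le> q"
  then have mq: "q < m" by simp
  have bound: "m \<le> (1 + t) * q" if t: "0 < t" "t \<le> 1" for t
  proof -
    have "t * m \<le> (exp t - 1) * q"
      using le[OF t] ln_add_one_self_le_self[of "(exp t - 1) * q"] t \<open>0 \<le> q\<close> by simp
    also have "\<dots> \<le> (t + t\<^sup>2) * q"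
      using exp_bound[of t] t \<open>0 \<le> q\<close> by (intro mult_right_mono) auto
    also have "\<dots> = t * ((1 + t) * q)" by (simp add: power2_eq_square algebra_simps)
    finally show ?thesis using t by simp
  qed
  then have "0 < q" using bound[of 1] mq \<open>0 \<le> q\<close> by (cases "q = 0") auto
  \<comment> \<open>Chosen so that \<open>t * q\<close> is at most half the gap
    \<open>m - q\<close>, while staying in the range where the bound on \<open>exp\<close>
    holds.\<close>
  define t where "t = min 1 ((m - q) / (2 * q))"
  have t: "0 < t" "t \<le> 1" using mq \<open>0 < q\<close> by (auto simp: t_def)
  have "t * q \<le> (m - q) / (2 * q) * q" using \<open>0 < q\<close> by (intro mult_right_mono) (auto simp: t_def)
  then have "t * q \<le> (m - q) / 2" using \<open>0 < q\<close> by simp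
  then show False using bound[OF t] mq by (simp add: distrib_right)
qed

text \<open>Applying the inequality to the complement reverses it, since both total masses are one.
  Hence a one-sided perturbation with t > 0 is enough in the equality case.\<close>

lemma prob_measure_eqI_le:
  assumes "prob_space M" "prob_space N" and s: "sets M = sets N"
    and le: "\<And>A. A \<in> sets M \<Longrightarrow> measure M A \<le> measure N A"
  shows "M = N"
proof (rule measure_eqI[OF s])
  interpret M: prob_space M by fact
  interpret N: prob_space N by fact
  fix A assume A: "A \<in> sets M"
  have "measure N A \<le> measure M A"
    using le[of "space M - A"] A s sets_eq_imp_space_eq[OF s] M.prob_compl[OF A] N.prob_compl[of A] by auto
  with le[OF A] show "emeasure M A = emeasure N A"
    by (simp add: M.emeasure_eq_measure N.emeasure_eq_measure)
qed

context bdd_potential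
begin

lemma prob_on_gibbs_marginal: "prob_on R (distr (gibbs R h) borel (\<lambda>x. x i))"
proof -
  have pr: "prob_space (distr (gibbs R h) borel (\<lambda>x. x i))"
    by (intro prob_space.prob_space_distr prob_space_gibbs) (simp add: measurable_cong_sets[OF sets_gibbs refl])
  have "AE x in distr (gibbs R h) borel (\<lambda>x. x i). x \<in> {-R..R}"
    unfolding marginal_density by (subst AE_density) (auto split: split_indicator)
  then have "emeasure (distr (gibbs R h) borel (\<lambda>x. x i)) {-R..R} = 1"
    by (intro prob_space.emeasure_eq_1_AE[OF pr]) auto
  with pr show ?thesis by (simp add: prob_on_def)
qed

text \<open>The value is finite, which excludes Gibbs marginals when some entropy is minus infinity,
  and it identifies the entropy terms in the reverse bound.\<close>

lemma entropy_BG_gibbs_marginal: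
  "entropy_BG (distr (gibbs R h) borel (\<lambda>x. x i))
     = ereal (- (\<integral>x. partial_h R h i x - pressure R h \<partial>distr (gibbs R h) borel (\<lambda>x. x i)))"
proof -
  let ?\<mu> = "distr (gibbs R h) borel (\<lambda>x. x i)" and ?l = "\<lambda>x. partial_h R h i x - pressure R h"
  let ?p = "\<lambda>x. indicator {-R..R} x * exp (?l x)"
  interpret prob_space ?\<mu> using prob_on_gibbs_marginal by (simp add: prob_on_def)
  obtain C where C: "\<And>x. \<bar>partial_h R h i x\<bar> \<le> C" using partial_h_bdd by blast
  have AE: "AE x in ?\<mu>. ln (?p x) = ?l x"
    using prob_on_AE[OF prob_on_gibbs_marginal[of i]] by eventually_elim simp
  have "\<bar>?l x\<bar> \<le> C + \<bar>pressure R h\<bar>" for x using C[of x] by simp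
  then have "integrable ?\<mu> ?l"
    by (intro integrable_const_bound[where B="C + \<bar>pressure R h\<bar>"]) auto
  then have "integrable ?\<mu> (\<lambda>x. ln (?p x))"
    by (subst integrable_cong_AE[OF _ _ AE]) auto
  moreover have "(\<integral>x. ln (?p x) \<partial>?\<mu>) = (\<integral>x. ?l x \<partial>?\<mu>)"
    by (intro integral_cong_AE AE) auto
  ultimately show ?thesis
    using entropy_BG_density[OF prob_on_gibbs_marginal marginal_density, of i] by simp
qed

end

lemma (in cts_potential) mutual_pressure_le_and_equality_iff:
  assumes \<mu>: "\<And>i. prob_on R (\<mu> i)" and \<xi>: "approximating R \<mu> \<xi>"
  shows "mutual_pressure h \<xi> + (\<Sum>i\<in>UNIV. entropy_BG (\<mu> i)) \<le> ereal (pressure R h)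
    \<and> (ereal (pressure R h) = mutual_pressure h \<xi> + (\<Sum>i\<in>UNIV. entropy_BG (\<mu> i))
           \<longleftrightarrow> (\<forall>i. \<mu> i = distr (gibbs R h) borel (\<lambda>x. x i)))"
proof -
  obtain B where B: "0 \<le> B" "\<And>x. \<bar>h x\<bar> \<le> B" using bounded_h by blast
  interpret bdd_potential R h B by unfold_locales (rule R measurable_h B)+
  interpret product_marginals \<mu> using \<mu> by (simp add: product_marginals_def prob_on_def)
  define b where "b N = ln (symm_avg h N (\<lambda>j i. \<xi> i N j)) / real N" for N
  define a where "a \<nu> N = (\<integral>w. ln (symm_avg h N w) \<partial>PiM {..<N} (\<lambda>_. \<nu>)) / real N" for \<nu> N
  have mp: "mutual_pressure h \<xi> = limsup (\<lambda>N. ereal (b N))"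
    unfolding mutual_pressure_symm_avg b_def ..
  have conv: "(\<lambda>N. a \<nu> N - b N) \<longlonglongrightarrow> 0"
    if "prob_space \<nu>" "sets \<nu> = sets (PiM UNIV (\<lambda>_. borel))" "\<And>i. distr \<nu> borel (\<lambda>x. x i) = \<mu> i" for \<nu>
    unfolding a_def b_def using that by (intro expected_ln_symm_avg_conv[OF _ _ _ \<mu> \<xi>])
  have marg: "distr (PiM UNIV \<mu>) borel (\<lambda>x. x i) = \<mu> i" for i
    using distr_PiM_component[of UNIV \<mu> i] prob sets_\<mu>
      distr_cong[of "PiM UNIV \<mu>" "PiM UNIV \<mu>" borel "\<mu> i" "\<lambda>x. x i" "\<lambda>x. x i"] by simp
  note conv\<pi> = conv[OF prob_space_prod sets_prod marg]
  \<comment> \<open>Makes the mutual pressure a real number, so that adding entropies in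
    \<open>ereal\<close> is unambiguous.\<close>
  have "\<bar>b N\<bar> \<le> B" for N
    using abs_ln_symm_avg_le[of h B N, OF B(2)] B(1) by (cases "N = 0") (auto simp: b_def abs_divide divide_le_eq mult.commute)
  then have "ereal (- B) \<le> limsup (\<lambda>N. ereal (b N))" "limsup (\<lambda>N. ereal (b N)) \<le> ereal B"
    by (auto intro!: limsup_ge_of_diff_tendsto_0[where a=b] limsup_le_of_diff_tendsto_0[where a=b] simp: abs_le_iff)
       (metis minus_le_iff)
  then obtain m where m: "mutual_pressure h \<xi> = ereal m"
    unfolding mp by (cases "limsup (\<lambda>N. ereal (b N))") auto
  show ?thesis
  proof (cases "\<exists>i. entropy_BG (\<mu> i) = -\<infinity>")
    case True
    then obtain i0 where i0: "entropy_BG (\<mu> i0) = -\<infinity>" by blast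
    \<comment> \<open>No other entropy can cancel the infinite one, so the right-hand side is minus
      infinity. Then the bound is trivial, and both sides of the equivalence are false.\<close>
    have "entropy_BG (\<mu> i) \<noteq> \<infinity>" for i
      by (rule entropy_BG_cases[OF \<mu>[of i]]) auto
    then have "(\<Sum>i\<in>UNIV. entropy_BG (\<mu> i)) = -\<infinity>"
      using i0 by (subst sum.remove[of _ i0]) (auto simp: sum_Pinfty)
    moreover have "\<mu> i0 \<noteq> distr (gibbs R h) borel (\<lambda>x. x i0)"
      using i0 entropy_BG_gibbs_marginal[of i0] by auto
    ultimately show ?thesis using m by auto
  next
    case False
    have "\<exists>p. p \<in> borel_measurable borel \<and> (\<forall>x. 0 \<le> p x) \<and> (\<forall>x. x \<notin> {-R..R} \<longrightarrow> p x = 0)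
        \<and> \<mu> i = density lborel (\<lambda>x. ennreal (p x)) \<and> integrable (\<mu> i) (\<lambda>x. ln (p x))
        \<and> entropy_BG (\<mu> i) = ereal (- integral\<^sup>L (\<mu> i) (\<lambda>x. ln (p x)))" for i
      using False by (rule_tac entropy_BG_cases[OF \<mu>[of i]]) blast+
    then obtain p where p: "\<And>i. p i \<in> borel_measurable borel" "\<And>i x. 0 \<le> p i x"
        "\<And>i x. x \<notin> {-R..R} \<Longrightarrow> p i x = 0" "\<And>i. \<mu> i = density lborel (\<lambda>x. ennreal (p i x))"
        "\<And>i. integrable (\<mu> i) (\<lambda>x. ln (p i x))"
      and ent: "\<And>i. entropy_BG (\<mu> i) = ereal (- integral\<^sup>L (\<mu> i) (\<lambda>x. ln (p i x)))"
      by metis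
    define S where "S = (\<Sum>i\<in>UNIV. integral\<^sup>L (\<mu> i) (\<lambda>x. ln (p i x)))"
    have sumH: "(\<Sum>i\<in>UNIV. entropy_BG (\<mu> i)) = ereal (- S)"
      by (simp add: ent S_def sum_negf)
    have le: "a (PiM UNIV \<mu>) N \<le> pressure R h + S" if "0 < N" for N
      unfolding a_def S_def by (rule expected_ln_symm_avg_le_pressure[OF \<mu> p that])
    have m_le: "m \<le> pressure R h + S"
      using limsup_le_of_diff_tendsto_0[OF conv\<pi> le] m mp by simp
    have "pressure R h = m - S \<longleftrightarrow> (\<forall>i. \<mu> i = distr (gibbs R h) borel (\<lambda>x. x i))"
    proof
      assume marg_h: "\<forall>i. \<mu> i = distr (gibbs R h) borel (\<lambda>x. x i)"
      let ?l = "\<lambda>i x. partial_h R h i x - pressure R h"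
      have "integral\<^sup>L (\<mu> i) (?l i) = integral\<^sup>L (\<mu> i) (\<lambda>x. ln (p i x))" for i
        using ent[of i] entropy_BG_gibbs_marginal[of i] marg_h by simp
      then have "pressure R h + S \<le> a (gibbs R h) N" if "0 < N" for N
        using expected_ln_symm_avg_gibbs_ge[of \<mu> N] marg_h that by (simp add: a_def S_def)
      then have "pressure R h + S \<le> m"
        using limsup_ge_of_diff_tendsto_0[OF conv[OF prob_space_gibbs sets_gibbs]] marg_h m mp by simp
      with m_le show "pressure R h = m - S" by simp
    next
      assume eq: "pressure R h = m - S"
      show "\<forall>i. \<mu> i = distr (gibbs R h) borel (\<lambda>x. x i)"
      proof
        fix i
        show "\<mu> i = distr (gibbs R h) borel (\<lambda>x. x i)"
        proof (rule prob_measure_eqI_le[OF prob])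
          show "prob_space (distr (gibbs R h) borel (\<lambda>x. x i))"
            using prob_on_gibbs_marginal by (simp add: prob_on_def)
          fix A assume "A \<in> sets (\<mu> i)"
          then have A[measurable]: "A \<in> sets borel" by (simp add: sets_\<mu>)
          show "measure (\<mu> i) A \<le> measure (distr (gibbs R h) borel (\<lambda>x. x i)) A"
          proof (rule le_of_linear_le_ln)
            fix t :: real assume t: "0 < t" "t \<le> 1"
            \<comment> \<open>The perturbation is separable, with one nonzero component, so in
              expectation it adds exactly \<open>real N * (t * measure (\<mu> i) A)\<close>.\<close>
            define f where "f k x = (if k = i then t * indicator A x else 0)" for k and x :: real
            define k where "k x = h x + (\<Sum>i\<in>UNIV. f i (x i))" for x
            have k_eq: "k = (\<lambda>x. h x + t * indicator A (x i))"
            proof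
              fix x
              have "(\<Sum>k\<in>UNIV. f k (x k)) = (\<Sum>k\<in>UNIV. if k = i then t * indicator A (x i) else 0)"
                by (intro sum.cong) (auto simp: f_def)
              then show "k x = h x + t * indicator A (x i)" by (simp add: k_def)
            qed
            note [measurable] = measurable_h
            have f: "f k \<in> borel_measurable borel" "integrable (\<mu> k) (f k)" for k
            proof -
              interpret K: prob_space "\<mu> k" by (rule prob)
              show m: "f k \<in> borel_measurable borel" unfolding f_def by measurable
              show "integrable (\<mu> k) (f k)"
                using t m by (intro K.integrable_const_bound[where B="\<bar>t\<bar>"])
                  (auto simp: f_def measurable_cong_sets[OF sets_\<mu> refl] split: split_indicator)
            qed
            \<comment> \<open>The perturbed potential need not be continuous. Only the bound for
              fixed N is applied to it; the passage to the limit below concerns \<open>h\<close>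
              alone.\<close>
            interpret K: bdd_potential R k "B + \<bar>t\<bar>"
            proof
              show "k \<in> borel_measurable (PiM UNIV (\<lambda>_. borel))" unfolding k_eq by measurable
              show "\<bar>k x\<bar> \<le> B + \<bar>t\<bar>" for x
                using B(2)[of x] by (auto simp: k_eq split: split_indicator)
            qed (rule R)
            have "integral\<^sup>L (\<mu> k) (f k) = (if k = i then t * measure (\<mu> i) A else 0)" for k
              using sets_eq_imp_space_eq[OF sets_\<mu>] by (simp add: f_def[abs_def])
            then have "(\<Sum>k\<in>UNIV. integral\<^sup>L (\<mu> k) (f k)) = t * measure (\<mu> i) A" by simp
            then have "(\<integral>w. ln (symm_avg k N w) \<partial>Q N)
                = (\<integral>w. ln (symm_avg h N w) \<partial>Q N) + real N * (t * measure (\<mu> i) A)" for N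
              using expected_ln_symm_avg_add_separate(2)[OF measurable_h B(2) prob_space_prod sets_prod marg f]
              by (simp add: Q_def k_def[abs_def])
            then have "a (PiM UNIV \<mu>) N \<le> pressure R k + S - t * measure (\<mu> i) A" if "0 < N" for N
              using K.expected_ln_symm_avg_le_pressure[of \<mu> p N, OF \<mu> p that] that
              by (simp add: a_def S_def Q_def add_divide_distrib)
            then have "m \<le> pressure R k + S - t * measure (\<mu> i) A"
              using limsup_le_of_diff_tendsto_0[OF conv\<pi>] m mp by simp
            then show "t * measure (\<mu> i) A \<le> ln (1 + (exp t - 1) * measure (distr (gibbs R h) borel (\<lambda>x. x i)) A)"
              using eq pressure_add_indicator[OF A, of t i] by (simp add: k_eq)
          qed simp
        qed (simp add: sets_\<mu>)
      qed
    qed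
    then show ?thesis using m m_le by (simp add: sumH)
  qed
qed

theorem theorem3p2:
  fixes R :: real
    and h :: "('n::finite \<Rightarrow> real) \<Rightarrow> real"
    and \<mu> :: "'n \<Rightarrow> real measure"
    and \<xi> :: "'n \<Rightarrow> nat \<Rightarrow> nat \<Rightarrow> real"
  assumes "R > 0"
    and "continuous_on (cube UNIV R) h"
    and "\<And>i. prob_on R (\<mu> i)"
    and "approximating R \<mu> \<xi>"
  shows "ereal (pressure R h) \<ge> mutual_pressure h \<xi> + (\<Sum>i\<in>UNIV. entropy_BG (\<mu> i))
    \<and> ((ereal (pressure R h) = mutual_pressure h \<xi> + (\<Sum>i\<in>UNIV. entropy_BG (\<mu> i)))
           \<longleftrightarrow> (\<forall>i. \<mu> i = distr (gibbs R h) borel (\<lambda>x. x i)))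
    \<and> ((\<forall>i. \<mu> i = distr (gibbs R h) borel (\<lambda>x. x i))
           \<longleftrightarrow> (\<forall>i. \<mu> i = gibbs1 R (partial_h R h i)))"
proof -
  \<comment> \<open>Continuity is given only on the cube, while the lemmas work with functions on
    the whole space. Every quantity in the claim is unchanged when \<open>h\<close> is replaced by
    \<open>H\<close>, because it sees \<open>h\<close> only on the cube.\<close>
  define H where "H x = h (\<lambda>i. clip R (x i))" for x
  have "continuous_on UNIV H"
    unfolding H_def
    by (rule continuous_on_compose2[OF assms(2)])
       (use \<open>R > 0\<close> clip_in[of R] in \<open>auto simp: cube_def PiE_iff intro!: continuous_intros\<close>)
  then interpret cts_potential R H
    using \<open>R > 0\<close> by unfold_locales (auto simp: H_def)
  obtain B where B: "0 \<le> B" "\<And>x. \<bar>H x\<bar> \<le> B" using bounded_h by blast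
  interpret bdd_potential R H B by unfold_locales (rule R measurable_h B)+
  have H: "H x = h x" if "x \<in> cube UNIV R" for x
    using that by (auto simp: H_def cube_def PiE_iff clip_id)
  have pressure: "pressure R h = pressure R H"
    unfolding pressure_def set_lebesgue_integral_def
    by (intro arg_cong[where f=ln] Bochner_Integration.integral_cong) (auto simp: H split: split_indicator)
  have gibbs: "gibbs R h = gibbs R H"
    unfolding gibbs_def pressure
    by (intro arg_cong[where f="density _"] ext) (auto simp: H split: split_indicator)
  have mutual: "mutual_pressure h \<xi> = mutual_pressure H \<xi>"
  proof -
    have "symm_avg h N (\<lambda>j i. \<xi> i N j) = symm_avg H N (\<lambda>j i. \<xi> i N j)" for N
    proof (rule symm_avg_cong)
      fix s :: "'n \<Rightarrow> nat \<Rightarrow> nat" and j assume "s \<in> perm_families N" "j < N"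
      then have "s i j < N" for i
        using permutes_in_image[of "s i" "{..<N}" j] by (auto simp: perm_families_iff)
      then have "(\<lambda>i. \<xi> i N (s i j)) \<in> cube UNIV R"
        using assms(4) by (auto simp: approximating_def cube_def PiE_iff)
      then show "h (\<lambda>i. \<xi> i N (s i j)) = H (\<lambda>i. \<xi> i N (s i j))" by (simp add: H)
    qed
    then show ?thesis by (simp add: mutual_pressure_symm_avg)
  qed
  \<comment> \<open>The two may differ for \<open>x\<close> outside the interval, but the indicator
    in \<open>gibbs1\<close> and the range of integration in \<open>pressure1\<close> hide those
    values.\<close>
  have partial: "partial_h R h i x = partial_h R H i x" if "x \<in> {-R..R}" for i x
    unfolding partial_h_def set_lebesgue_integral_def
  proof (intro arg_cong[where f=ln] Bochner_Integration.integral_cong refl)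
    fix y :: "'n \<Rightarrow> real"
    have "y(i := x) \<in> cube UNIV R" if "y \<in> cube (UNIV - {i}) R"
      using that \<open>x \<in> {-R..R}\<close> by (auto simp: cube_def PiE_iff)
    then show "indicator (cube (UNIV - {i}) R) y *\<^sub>R exp (h (y(i := x)))
             = indicator (cube (UNIV - {i}) R) y *\<^sub>R exp (H (y(i := x)))"
      by (auto simp: H split: split_indicator)
  qed
  have "pressure1 R (partial_h R h i) = pressure1 R (partial_h R H i)" for i
    unfolding pressure1_def set_lebesgue_integral_def
    by (intro arg_cong[where f=ln] Bochner_Integration.integral_cong) (auto simp: partial split: split_indicator)
  then have "gibbs1 R (partial_h R h i) = gibbs1 R (partial_h R H i)" for i
    unfolding gibbs1_def
    by (intro arg_cong[where f="density _"] ext) (auto simp: partial split: split_indicator)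
  then have "distr (gibbs R h) borel (\<lambda>x. x i) = gibbs1 R (partial_h R h i)" for i
    by (simp add: gibbs marginal_gibbs1)
  then show ?thesis
    using mutual_pressure_le_and_equality_iff[OF assms(3,4)] by (simp add: pressure gibbs mutual)
qed

end
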